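(* Let $W$ be a singular memoryless channel with lattice span $h\ge0$, with fixed input distribution $P_X$, satisfying the standing assumptions in the context, and let $0<R<I(X;Y)$ be fixed with $R\le R_{\mathrm{crit}}$. Then, as $n\to\infty$, $$ P_{\mathrm{RC}}(n)=\begin{cases}(1/2+o(1))\,e^{-nE_r(R)}, & \text{if }R<R_{\mathrm{crit}},\\ (1/4+o(1))\,e^{-nE_r(R)}, & \text{if }R=R_{\mathrm{crit}}.\end{cases} $$
   Context: Channel. A memoryless channel has input alphabet $\mathcal X$, output alphabet $\mathcal Y$ and output distributions $W(\cdot|x)$, $x\in\mathcal X$, all absolutely continuous with respect to a common base measure $Q$; $W(y|x)$ also denotes the density $\frac{dW(\cdot|x)}{dQ}(y)$. Fix an input distribution $P_X$ on $\mathcal X$. Let $X\sim P_X$, let $Y\sim W(\cdot|X)$ given $X$, and let $X'\sim P_X$ be independent of $(X,Y)$. Put $\nu(X,Y,x')=\log\frac{W(Y|x')}{W(Y|X)}\in[-\infty,\infty)$, which is well defined almost surely. $\mathrm E_{X'}$ denotes expectation over $X'$ for given $(X,Y)$. It is assumed that $I(X;Y)=\mathrm E_{XY}[-\log \mathrm E_{X'}[e^{\nu(X,Y,X')}]]<\infty$. Random code. For blocklength $n$ and rate $R$ the code has $M=\lceil e^{nR}\rceil$ codewords in $\mathcal X^n$, all of whose letters are i.i.d. from $P_X$. A codeword is sent over $n$ independent uses of $W$ and decoded by maximum likelihood, i.e. by maximizing $\sum_{i=1}^n\log W(Y_i|x_i)$ over the codewords $(x_1,\dots,x_n)$, ties being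 broken uniformly at random. $P_{\mathrm{RC}}(n)$ is the decoding error probability averaged over the random code, the channel and the tie-breaking. Exponent. For $\lambda>0$ let $Z(\lambda)=\log \mathrm E_{X'}[e^{\lambda\nu(X,Y,X')}]$ (a random variable depending on $(X,Y)$), with $m$-th $\lambda$-derivative $Z^{(m)}(\lambda)$. For $0<R<I(X;Y)$, $$E_r(R)=-\min_{\alpha\in(0,1]}\{\alpha R+\log \mathrm E[e^{\alpha Z(1/(1+\alpha))}]\},$$ $\rho$ denotes the minimizing $\alpha$ and $\eta=1/(1+\rho)$. $R_{\mathrm{crit}}$ is the largest $R$ for which the minimizer is $\rho=1$ (it equals $I(X;Y)$ if this is so for all $R<I(X;Y)$). $P_\rho$ is the probability measure with $dP_\rho/dP=e^{\rho Z(\eta)-\Lambda(\rho)}$, $\Lambda(\rho)=\log \mathrm E[e^{\rho Z(1/(1+\rho))}]$, with expectation $\mathrm E_\rho$. Singularity and lattice. $W$ is singular if $P_{X'}[\nu(X,Y,X')\in\{-\infty,0\}]=1$ for almost every $(X,Y)$. A random variable $V\in\mathbb R\cup\{-\infty\}$ that is not supported on $\{-\infty,v\}$ for a single $v\in\mathbb R$ has a lattice distribution with span $h>0$ and offset $a$ if $V\in\{a+ih:i\in\mathbb Z\}\cup\{-\infty\}$ a.s. and $h$ is the largest number with this property. $W$ has lattice span $h>0$ if $\nu(X,Y,X')$ has a lattice distribution with span $h$; otherwise its span is $h=0$. Regularity (standing assumption). Let $Z(\lambda+\mathrm i\xi)=\log \mathrm E_{X'}[e^{(\lambda+\mathrm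 i\xi)\nu(X,Y,X')}]$ and $Z_{\mathrm a}(\lambda+\mathrm i\xi)=\log|\mathrm E_{X'}[e^{(\lambda+\mathrm i\xi)\nu(X,Y,X')}]|$, with $e^{(\lambda+\mathrm i\xi)(-\infty)}=0$. There exist $\alpha,b_0>0$ and a neighborhood $\mathcal S$ of $\eta$ such that for any $0<b_1<b_2<2\pi/h\le\infty$: $\sup_{\lambda\in\mathcal S}\mathrm E_\rho[e^{\alpha|Z^{(i)}(\lambda)|}]<\infty$ for $i=1,2,3$; $\sup_{\lambda\in\mathcal S,\,\xi\in[-b_0,b_0]}\mathrm E_\rho[e^{\alpha|(\partial^4/\partial\xi^4)Z(\lambda+\mathrm i\xi)|}]<\infty$; $\sup_{\lambda\in\mathcal S,\,\xi\in[b_1,b_2]}\mathrm E_\rho[e^{\alpha|Z_{\mathrm a}(\lambda+\mathrm i\xi)-Z_{\mathrm a}(\lambda)|}]<\infty$. *)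

theory Defs
  imports "HOL-Probability.Probability"
begin

section \<open>Channel\<close>

text \<open>
  The input alphabet is the space of \<open>P\<close> (the input distribution), the output alphabet is the
  space of the base measure \<open>Q\<close>, and \<open>w x y\<close> is a jointly measurable version of the density
  \<open>W(y|x)\<close> of the output distribution with respect to \<open>Q\<close>.
\<close>

definition output_dist :: "'y measure \<Rightarrow> ('x \<Rightarrow> 'y \<Rightarrow> real) \<Rightarrow> 'x \<Rightarrow> 'y measure" where
  "output_dist Q w x = density Q (\<lambda>y. ennreal (w x y))"

definition channel_with_input :: "'x measure \<Rightarrow> 'y measure \<Rightarrow> ('x \<Rightarrow> 'y \<Rightarrow> real) \<Rightarrow> bool" where
  "channel_with_input P Q w \<longleftrightarrow>
     prob_space P \<and> sigma_finite_measure Q \<and>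
     case_prod w \<in> borel_measurable (P \<Otimes>\<^sub>M Q) \<and>
     (\<forall>x\<in>space P. \<forall>y\<in>space Q. 0 \<le> w x y) \<and>
     (\<forall>x\<in>space P. prob_space (output_dist Q w x))"

text \<open>Joint law of \<open>(X, Y)\<close> with \<open>X \<sim> P\<close> and \<open>Y \<sim> W(\<cdot>|X)\<close> given \<open>X\<close>.\<close>

definition joint :: "'x measure \<Rightarrow> 'y measure \<Rightarrow> ('x \<Rightarrow> 'y \<Rightarrow> real) \<Rightarrow> ('x \<times> 'y) measure" where
  "joint P Q w = density (P \<Otimes>\<^sub>M Q) (\<lambda>(x, y). ennreal (w x y))"

text \<open>The value for \<open>w x y = 0\<close> is irrelevant, since \<open>W(Y|X) > 0\<close> almost surely.\<close>

definition nu :: "('x \<Rightarrow> 'y \<Rightarrow> real) \<Rightarrow> 'x \<Rightarrow> 'y \<Rightarrow> 'x \<Rightarrow> ereal" where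
  "nu w x y x' = (if w x' y = 0 then -\<infinity> else ereal (ln (w x' y / w x y)))"

text \<open>\<open>e\<^sup>s\<^sup>v\<close> with \<open>e\<^sup>s\<^sup>(\<^sup>-\<^sup>\<infinity>\<^sup>) = 0\<close>, for a real or complex \<open>s\<close>.\<close>

definition exp_mult :: "'a::{real_normed_field,banach} \<Rightarrow> ereal \<Rightarrow> 'a" where
  "exp_mult s v = (if v = -\<infinity> then 0 else exp (s * of_real (real_of_ereal v)))"

text \<open>\<open>E\<^bsub>X'\<^esub>[e\<^sup>s\<^sup>\<nu>\<^sup>(\<^sup>x\<^sup>,\<^sup>y\<^sup>,\<^sup>X\<^sup>'\<^sup>)]\<close>, for a real or complex \<open>s\<close>.\<close>

definition mgf ::
  "'x measure \<Rightarrow> ('x \<Rightarrow> 'y \<Rightarrow> real) \<Rightarrow> 'x \<times> 'y \<Rightarrow>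
   'a::{real_normed_field,banach,second_countable_topology} \<Rightarrow> 'a" where
  "mgf P w = (\<lambda>(x, y) s. \<integral>x'. exp_mult s (nu w x y x') \<partial>P)"

definition Z :: "'x measure \<Rightarrow> ('x \<Rightarrow> 'y \<Rightarrow> real) \<Rightarrow> 'x \<times> 'y \<Rightarrow> real \<Rightarrow> real" where
  "Z P w xy l = ln (mgf P w xy l)"

definition mutual_info :: "'x measure \<Rightarrow> 'y measure \<Rightarrow> ('x \<Rightarrow> 'y \<Rightarrow> real) \<Rightarrow> real" where
  "mutual_info P Q w = (\<integral>xy. - ln (mgf P w xy (1::real)) \<partial>joint P Q w)"

text \<open>The library's mutual information of the two coordinates, in nats, is the same quantity.\<close>

lemma mutual_info_eq_mutual_information:
  fixes P :: "'x measure" and Q :: "'y measure"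
  assumes "channel_with_input P Q w"
  shows "mutual_info P Q w = prob_space.mutual_information (joint P Q w) (exp 1) P Q fst snd"
proof -
  interpret P: prob_space P
    using assms by (simp add: channel_with_input_def)
  interpret Q: sigma_finite_measure Q
    using assms by (simp add: channel_with_input_def)
  interpret PQ: pair_sigma_finite P Q ..
  have wm [measurable]: "case_prod w \<in> borel_measurable (P \<Otimes>\<^sub>M Q)"
    and w0: "\<And>x y. x \<in> space P \<Longrightarrow> y \<in> space Q \<Longrightarrow> 0 \<le> w x y"
    and wp: "\<And>x. x \<in> space P \<Longrightarrow> prob_space (output_dist Q w x)"
    using assms by (auto simp: channel_with_input_def)
  have wmy [measurable]: "w x \<in> borel_measurable Q" if "x \<in> space P" for x
    using measurable_compose[OF measurable_Pair1'[OF that] wm] by simp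
  have wmx [measurable]: "(\<lambda>x. w x y) \<in> borel_measurable P" if "y \<in> space Q" for y
    using measurable_compose[OF measurable_Pair2'[OF that] wm] by simp
  have w1: "(\<integral>\<^sup>+y. ennreal (w x y) \<partial>Q) = 1" if "x \<in> space P" for x
  proof -
    interpret W: prob_space "output_dist Q w x"
      using wp[OF that] .
    show ?thesis
      using W.emeasure_space_1 that by (simp add: output_dist_def emeasure_density cong: nn_integral_cong)
  qed
  have tot: "(\<integral>\<^sup>+y. (\<integral>\<^sup>+x. ennreal (w x y) \<partial>P) \<partial>Q) = 1"
    by (subst PQ.Fubini') (auto simp: w1 P.emeasure_space_1 cong: nn_integral_cong)
  define q where "q y = (\<integral>x. w x y \<partial>P)" for y
  have qm [measurable]: "q \<in> borel_measurable Q"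
    unfolding q_def by measurable
  have q0: "0 \<le> q y" if "y \<in> space Q" for y
    unfolding q_def using w0 that by (intro integral_nonneg_AE) auto
  have fin: "AE y in Q. (\<integral>\<^sup>+x. ennreal (w x y) \<partial>P) \<noteq> \<infinity>"
    by (rule nn_integral_PInf_AE) (auto simp: tot)
  have q_eq: "AE y in Q. (\<integral>\<^sup>+x. ennreal (w x y) \<partial>P) = ennreal (q y)"
    using fin AE_space
  proof eventually_elim
    case (elim y)
    have "integrable P (\<lambda>x. w x y)"
      using elim w0 by (intro integrableI_nonneg) (auto simp: top.not_eq_extremum)
    then show ?case
      unfolding q_def using elim w0 by (intro nn_integral_eq_integral) auto
  qed
  have J: "prob_space (joint P Q w)"
  proof
    show "emeasure (joint P Q w) (space (joint P Q w)) = 1"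
      unfolding joint_def
      by (simp add: emeasure_density Q.nn_integral_fst[symmetric] w1 P.emeasure_space_1
          cong: nn_integral_cong_simp)
  qed
  interpret J: information_space "joint P Q w" "exp 1"
    using J by (simp add: information_space_def information_space_axioms_def)
  have sets_J [measurable_cong]: "sets (joint P Q w) = sets (P \<Otimes>\<^sub>M Q)"
    by (simp add: joint_def)
  have mgfm [measurable]: "(\<lambda>z. mgf P w z (1::real)) \<in> borel_measurable (P \<Otimes>\<^sub>M Q)"
  proof -
    have [measurable]: "(\<lambda>(z, x'). w x' (snd z)) \<in> borel_measurable ((P \<Otimes>\<^sub>M Q) \<Otimes>\<^sub>M P)"
      using measurable_compose[of "\<lambda>(z, x'). (x', snd z)" "(P \<Otimes>\<^sub>M Q) \<Otimes>\<^sub>M P" "P \<Otimes>\<^sub>M Q", OF _ wm]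
      by (simp add: case_prod_beta)
    have [measurable]: "(\<lambda>(z, x'). w (fst z) (snd z)) \<in> borel_measurable ((P \<Otimes>\<^sub>M Q) \<Otimes>\<^sub>M P)"
      using measurable_compose[of "\<lambda>(z, x'). (fst z, snd z)" "(P \<Otimes>\<^sub>M Q) \<Otimes>\<^sub>M P" "P \<Otimes>\<^sub>M Q", OF _ wm]
      by (simp add: case_prod_beta)
    have "(\<lambda>z. \<integral>x'. (if w x' (snd z) = 0 then 0 else exp (ln (w x' (snd z) / w (fst z) (snd z)))) \<partial>P)
        \<in> borel_measurable (P \<Otimes>\<^sub>M Q)"
      by measurable
    also have "(\<lambda>z. \<integral>x'. (if w x' (snd z) = 0 then 0 else exp (ln (w x' (snd z) / w (fst z) (snd z)))) \<partial>P)
        = (\<lambda>z. mgf P w z (1::real))"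
      by (auto simp: mgf_def exp_mult_def nu_def case_prod_beta fun_eq_iff intro!: Bochner_Integration.integral_cong)
    finally show ?thesis .
  qed
  have d1: "distributed (joint P Q w) P fst (\<lambda>_. ennreal 1)"
    unfolding distributed_def
  proof (intro conjI measure_eqI)
    fix A assume "A \<in> sets (distr (joint P Q w) P fst)"
    then have A [measurable]: "A \<in> sets P" by simp
    have "emeasure (distr (joint P Q w) P fst) A = (\<integral>\<^sup>+x. indicator A x \<partial>distr (joint P Q w) P fst)"
      by (subst nn_integral_indicator) auto
    also have "\<dots> = (\<integral>\<^sup>+z. ennreal (case_prod w z) * indicator A (fst z) \<partial>(P \<Otimes>\<^sub>M Q))"
      by (subst nn_integral_distr, simp, simp, unfold joint_def, subst nn_integral_density)
         (auto simp: case_prod_beta)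
    also have "\<dots> = (\<integral>\<^sup>+x. \<integral>\<^sup>+y. ennreal (w x y) * indicator A x \<partial>Q \<partial>P)"
      by (subst Q.nn_integral_fst[symmetric]) (auto simp: case_prod_beta)
    also have "\<dots> = (\<integral>\<^sup>+x. indicator A x \<partial>P)"
      by (intro nn_integral_cong) (simp add: nn_integral_multc w1)
    finally show "emeasure (distr (joint P Q w) P fst) A = emeasure (density P (\<lambda>_. ennreal 1)) A"
      by (simp add: emeasure_density)
  qed auto
  have d2: "distributed (joint P Q w) Q snd (\<lambda>y. ennreal (q y))"
    unfolding distributed_def
  proof (intro conjI measure_eqI)
    fix A assume "A \<in> sets (distr (joint P Q w) Q snd)"
    then have A [measurable]: "A \<in> sets Q" by simp
    have "emeasure (distr (joint P Q w) Q snd) A = (\<integral>\<^sup>+x. indicator A x \<partial>distr (joint P Q w) Q snd)"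
      by (subst nn_integral_indicator) auto
    also have "\<dots> = (\<integral>\<^sup>+z. ennreal (case_prod w z) * indicator A (snd z) \<partial>(P \<Otimes>\<^sub>M Q))"
      by (subst nn_integral_distr, simp, simp, unfold joint_def, subst nn_integral_density)
         (auto simp: case_prod_beta)
    also have "\<dots> = (\<integral>\<^sup>+y. \<integral>\<^sup>+x. ennreal (w x y) * indicator A y \<partial>P \<partial>Q)"
      by (subst PQ.nn_integral_snd[symmetric]) (auto simp: case_prod_beta)
    also have "\<dots> = (\<integral>\<^sup>+y. ennreal (q y) * indicator A y \<partial>Q)"
      using q_eq AE_space by (intro nn_integral_cong_AE, eventually_elim) (simp add: nn_integral_multc)
    finally show "emeasure (distr (joint P Q w) Q snd) A = emeasure (density Q (\<lambda>y. ennreal (q y))) A"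
      by (simp add: emeasure_density)
  qed auto
  have d3: "distributed (joint P Q w) (P \<Otimes>\<^sub>M Q) (\<lambda>z. (fst z, snd z)) (\<lambda>z. ennreal (case_prod w z))"
    unfolding distributed_def
  proof (intro conjI)
    have "(\<lambda>(x, y). ennreal (w x y)) = (\<lambda>z. ennreal (case_prod w z))"
      by auto
    then show "distr (joint P Q w) (P \<Otimes>\<^sub>M Q) (\<lambda>z. (fst z, snd z)) =
        density (P \<Otimes>\<^sub>M Q) (\<lambda>z. ennreal (case_prod w z))"
      by (simp add: joint_def distr_id2)
  qed auto
  have "J.mutual_information (exp 1) P Q fst snd =
      (\<integral>z. case_prod w z * log (exp 1) (case_prod w z / (1 * q (snd z))) \<partial>(P \<Otimes>\<^sub>M Q))"
    by (intro J.mutual_information_distr d1 d2 d3 P.sigma_finite_measure_axioms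
        Q.sigma_finite_measure_axioms) (auto simp: w0 q0)
  also have "\<dots> = (\<integral>z. case_prod w z * - ln (mgf P w z (1::real)) \<partial>(P \<Otimes>\<^sub>M Q))"
  proof (intro Bochner_Integration.integral_cong refl, clarsimp simp: space_pair_measure)
    fix x y assume xy: "x \<in> space P" "y \<in> space Q"
    show "w x y * log (exp 1) (w x y / q y) = - (w x y * ln (mgf P w (x, y) (1::real)))"
    proof (cases "w x y = 0")
      case False
      with w0[OF xy] have pos: "w x y > 0" by simp
      have "mgf P w (x, y) (1::real) = (\<integral>x'. w x' y / w x y \<partial>P)"
        unfolding mgf_def prod.case
      proof (intro Bochner_Integration.integral_cong refl)
        fix x' assume "x' \<in> space P"
        with w0[of x' y] xy pos show "exp_mult 1 (nu w x y x') = w x' y / w x y"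
          by (auto simp: exp_mult_def nu_def)
      qed
      also have "\<dots> = q y / w x y"
        by (simp add: q_def)
      finally have "mgf P w (x, y) (1::real) = q y / w x y" .
      with pos q0[OF xy(2)] show ?thesis
        by (cases "q y = 0") (auto simp: log_def ln_div algebra_simps)
    qed simp
  qed
  also have "\<dots> = mutual_info P Q w"
  proof -
    have eq: "(\<lambda>(x, y). ennreal (w x y)) = (\<lambda>z. ennreal (case_prod w z))"
      by auto
    show ?thesis
      unfolding mutual_info_def joint_def eq
      by (subst integral_density) (auto simp: space_pair_measure w0 intro!: AE_I2)
  qed
  finally show ?thesis by simp
qed

text \<open>
  The negative part of \<open>- log E\<^bsub>X'\<^esub>[e\<^sup>\<nu>]\<close> always has finite expectation (as for any Kullback-Leibler
  divergence), so integrability is the same as \<open>I(X;Y) < \<infinity>\<close>.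
\<close>

definition finite_mutual_info :: "'x measure \<Rightarrow> 'y measure \<Rightarrow> ('x \<Rightarrow> 'y \<Rightarrow> real) \<Rightarrow> bool" where
  "finite_mutual_info P Q w \<longleftrightarrow> integrable (joint P Q w) (\<lambda>xy. - ln (mgf P w xy (1::real)))"


section \<open>Random coding error probability\<close>

definition num_codewords :: "real \<Rightarrow> nat \<Rightarrow> nat" where
  "num_codewords R n = nat \<lceil>exp (real n * R)\<rceil>"

text \<open>A code is a function \<open>c\<close>: letter \<open>i < n\<close> of codeword \<open>j < M\<close> is \<open>c j i\<close>.\<close>

definition random_code :: "'x measure \<Rightarrow> nat \<Rightarrow> nat \<Rightarrow> (nat \<Rightarrow> nat \<Rightarrow> 'x) measure" where
  "random_code P M n = (\<Pi>\<^sub>M j\<in>{..<M}. \<Pi>\<^sub>M i\<in>{..<n}. P)"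

definition log_likelihood ::
  "('x \<Rightarrow> 'y \<Rightarrow> real) \<Rightarrow> nat \<Rightarrow> (nat \<Rightarrow> 'x) \<Rightarrow> (nat \<Rightarrow> 'y) \<Rightarrow> ereal" where
  "log_likelihood w n x y = (\<Sum>i<n. if w (x i) (y i) = 0 then -\<infinity> else ereal (ln (w (x i) (y i))))"

definition ml_set ::
  "('x \<Rightarrow> 'y \<Rightarrow> real) \<Rightarrow> nat \<Rightarrow> nat \<Rightarrow> (nat \<Rightarrow> nat \<Rightarrow> 'x) \<Rightarrow> (nat \<Rightarrow> 'y) \<Rightarrow> nat set" where
  "ml_set w M n c y =
     {j. j < M \<and> (\<forall>k<M. log_likelihood w n (c k) y \<le> log_likelihood w n (c j) y)}"

text \<open>
  The decoder returns the index of a codeword; an index other than that of the sent codeword is an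
  error, even when the two codewords coincide as sequences.
\<close>

definition decoder ::
  "('x \<Rightarrow> 'y \<Rightarrow> real) \<Rightarrow> nat \<Rightarrow> nat \<Rightarrow> (nat \<Rightarrow> nat \<Rightarrow> 'x) \<Rightarrow> (nat \<Rightarrow> 'y) \<Rightarrow> nat pmf" where
  "decoder w M n c y = pmf_of_set (ml_set w M n c y)"

definition error_prob ::
  "'y measure \<Rightarrow> ('x \<Rightarrow> 'y \<Rightarrow> real) \<Rightarrow> nat \<Rightarrow> nat \<Rightarrow> (nat \<Rightarrow> nat \<Rightarrow> 'x) \<Rightarrow> nat \<Rightarrow> real" where
  "error_prob Q w M n c m =
     (\<integral>y. measure_pmf.prob (decoder w M n c y) {j. j \<noteq> m}
        \<partial>(\<Pi>\<^sub>M i\<in>{..<n}. output_dist Q w (c m i)))"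

text \<open>The index of the sent codeword is uniform.\<close>

definition P_RC :: "'x measure \<Rightarrow> 'y measure \<Rightarrow> ('x \<Rightarrow> 'y \<Rightarrow> real) \<Rightarrow> real \<Rightarrow> nat \<Rightarrow> real" where
  "P_RC P Q w R n =
     (let M = num_codewords R n in
      (\<Sum>m<M. \<integral>c. error_prob Q w M n c m \<partial>random_code P M n) / real M)"


section \<open>Error exponent and critical rate\<close>

definition Lambda :: "'x measure \<Rightarrow> 'y measure \<Rightarrow> ('x \<Rightarrow> 'y \<Rightarrow> real) \<Rightarrow> real \<Rightarrow> real" where
  "Lambda P Q w a = ln (\<integral>xy. exp (a * Z P w xy (1 / (1 + a))) \<partial>joint P Q w)"

text \<open>For \<open>0 < R < I(X;Y)\<close> the minimum over the half-open interval is attained.\<close>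

definition rho :: "'x measure \<Rightarrow> 'y measure \<Rightarrow> ('x \<Rightarrow> 'y \<Rightarrow> real) \<Rightarrow> real \<Rightarrow> real" where
  "rho P Q w R = (ARG_MIN (\<lambda>a. a * R + Lambda P Q w a) a. a \<in> {0<..1})"

definition E_r :: "'x measure \<Rightarrow> 'y measure \<Rightarrow> ('x \<Rightarrow> 'y \<Rightarrow> real) \<Rightarrow> real \<Rightarrow> real" where
  "E_r P Q w R = - (INF a\<in>{0<..1}. a * R + Lambda P Q w a)"

definition eta :: "'x measure \<Rightarrow> 'y measure \<Rightarrow> ('x \<Rightarrow> 'y \<Rightarrow> real) \<Rightarrow> real \<Rightarrow> real" where
  "eta P Q w R = 1 / (1 + rho P Q w R)"

definition R_crit :: "'x measure \<Rightarrow> 'y measure \<Rightarrow> ('x \<Rightarrow> 'y \<Rightarrow> real) \<Rightarrow> real" where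
  "R_crit P Q w =
     (if \<forall>R\<in>{0<..<mutual_info P Q w}. rho P Q w R = 1 then mutual_info P Q w
      else GREATEST R. R \<in> {0<..<mutual_info P Q w} \<and> rho P Q w R = 1)"

definition tilted :: "'x measure \<Rightarrow> 'y measure \<Rightarrow> ('x \<Rightarrow> 'y \<Rightarrow> real) \<Rightarrow> real \<Rightarrow> ('x \<times> 'y) measure" where
  "tilted P Q w R =
     density (joint P Q w)
       (\<lambda>xy. ennreal (exp (rho P Q w R * Z P w xy (eta P Q w R) - Lambda P Q w (rho P Q w R))))"


section \<open>Singularity and lattice span\<close>

definition singular :: "'x measure \<Rightarrow> 'y measure \<Rightarrow> ('x \<Rightarrow> 'y \<Rightarrow> real) \<Rightarrow> bool" where
  "singular P Q w \<longleftrightarrow> (AE (x, y) in joint P Q w. AE x' in P. nu w x y x' \<in> {-\<infinity>, 0})"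

definition supported_on_lattice ::
  "'a measure \<Rightarrow> ('a \<Rightarrow> ereal) \<Rightarrow> real \<Rightarrow> real \<Rightarrow> bool" where
  "supported_on_lattice M V a h \<longleftrightarrow>
     (AE z in M. V z \<in> insert (-\<infinity>) (range (\<lambda>i::int. ereal (a + of_int i * h))))"

text \<open>The span is the largest one over all possible offsets.\<close>

definition lattice_dist :: "'a measure \<Rightarrow> ('a \<Rightarrow> ereal) \<Rightarrow> real \<Rightarrow> real \<Rightarrow> bool" where
  "lattice_dist M V a h \<longleftrightarrow>
     \<not> (\<exists>v::real. AE z in M. V z \<in> {-\<infinity>, ereal v}) \<and>
     0 < h \<and> supported_on_lattice M V a h \<and>
     (\<forall>h'>0. (\<exists>a'. supported_on_lattice M V a' h') \<longrightarrow> h' \<le> h)"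

definition nu_lattice_dist ::
  "'x measure \<Rightarrow> 'y measure \<Rightarrow> ('x \<Rightarrow> 'y \<Rightarrow> real) \<Rightarrow> real \<Rightarrow> real \<Rightarrow> bool" where
  "nu_lattice_dist P Q w = lattice_dist (joint P Q w \<Otimes>\<^sub>M P) (\<lambda>((x, y), x'). nu w x y x')"

definition has_lattice_span ::
  "'x measure \<Rightarrow> 'y measure \<Rightarrow> ('x \<Rightarrow> 'y \<Rightarrow> real) \<Rightarrow> real \<Rightarrow> bool" where
  "has_lattice_span P Q w h \<longleftrightarrow>
     (if \<exists>h' a. nu_lattice_dist P Q w a h' then \<exists>a. nu_lattice_dist P Q w a h else h = 0)"


section \<open>Regularity\<close>

text \<open>
  \<open>Z(\<lambda> + i\<xi>)\<close> is determined only up to the choice of a branch of the logarithm. Near a given \<open>\<xi>\<close>,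
  dividing by the value at \<open>\<xi>\<close> changes \<open>Z\<close> by a constant and makes the principal branch
  smooth there, so the following is the fourth derivative for every continuous branch.
\<close>

definition Z_deriv4 ::
  "'x measure \<Rightarrow> ('x \<Rightarrow> 'y \<Rightarrow> real) \<Rightarrow> 'x \<times> 'y \<Rightarrow> real \<Rightarrow> real \<Rightarrow> complex" where
  "Z_deriv4 P w xy l \<xi> =
     ((\<lambda>f t. vector_derivative f (at t)) ^^ 4)
       (\<lambda>t. Ln (mgf P w xy (Complex l t) / mgf P w xy (Complex l \<xi>))) \<xi>"

definition Z_a :: "'x measure \<Rightarrow> ('x \<Rightarrow> 'y \<Rightarrow> real) \<Rightarrow> 'x \<times> 'y \<Rightarrow> complex \<Rightarrow> real" where
  "Z_a P w xy s = ln (cmod (mgf P w xy s))"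

text \<open>
  Where the moment generating function vanishes at a complex argument, \<open>Z\<^sub>a = -\<infinity>\<close> and \<open>Z\<close> is
  undefined; the integrands of the last two conditions are then \<open>\<infinity>\<close>. For \<open>h = 0\<close> there is no upper
  bound on \<open>b\<^sub>2\<close>.
\<close>

definition regular ::
  "'x measure \<Rightarrow> 'y measure \<Rightarrow> ('x \<Rightarrow> 'y \<Rightarrow> real) \<Rightarrow> real \<Rightarrow> real \<Rightarrow> bool" where
  "regular P Q w h R \<longleftrightarrow>
     (\<exists>\<alpha>>0. \<exists>b0>0. \<exists>S. open S \<and> eta P Q w R \<in> S \<and> S \<subseteq> {0<..} \<and>
       (\<forall>b1 b2. 0 < b1 \<and> b1 < b2 \<and> (0 < h \<longrightarrow> b2 < 2 * pi / h) \<longrightarrow>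
         (\<forall>i\<in>{1, 2, 3::nat}.
            (SUP l\<in>S. \<integral>\<^sup>+xy. ennreal (exp (\<alpha> * \<bar>(deriv ^^ i) (Z P w xy) l\<bar>))
               \<partial>tilted P Q w R) < \<infinity>) \<and>
         (SUP (l, \<xi>)\<in>S \<times> {-b0..b0}. \<integral>\<^sup>+xy.
            (if mgf P w xy (Complex l \<xi>) = 0 then \<infinity>
             else ennreal (exp (\<alpha> * cmod (Z_deriv4 P w xy l \<xi>))))
            \<partial>tilted P Q w R) < \<infinity> \<and>
         (SUP (l, \<xi>)\<in>S \<times> {b1..b2}. \<integral>\<^sup>+xy.
            (if mgf P w xy (Complex l \<xi>) = 0 then \<infinity>
             else ennreal (exp (\<alpha> * \<bar>Z_a P w xy (Complex l \<xi>) - Z_a P w xy (complex_of_real l)\<bar>)))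
            \<partial>tilted P Q w R) < \<infinity>))"

end

(*  A singular channel has, for almost every output y, a single positive likelihood v y, so a
    competing codeword either ties with the sent one or is impossible.  Summing the probability of
    correct decoding over the messages gives the integral of max_k W(y|x_k), which equals v y times
    the indicator that some codeword is compatible with y; hence the error probability is exactly the
    expectation of 1 - (1 - (1 - q)^M) / (M q), where q = exp (- (V_1 + ... + V_n)) is the probability
    that a random codeword is compatible with the output and the V_i = - Z are i.i.d. and nonnegative.
    This quantity is close to M q / 2 for small M q and at most 1.  Under the measure tilted by
    exp (- V), the sum of the V_i has mean n R_1 with R_1 = - Lambda'(1), and by Jensen's inequality
    R_1 is the critical rate.  Below R_1 a Chernoff bound shows that M q is negligible; at R_1 the
    central limit theorem makes M q tend to 0 or to infinity with probability 1/2 each.  *)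

theory Submission
  imports Defs "HOL-Real_Asymp.Real_Asymp"
begin

text \<open>The normaliser \<open>exp (n * R)\<close> times E[q] is exactly
  \<open>exp (- n * E_r)\<close>, because the minimizing \<alpha> is 1; so only the limit of one
  ratio is at stake. The factor 1/2 is the chance of losing a tie against a single competitor; at
  the critical rate it survives only on the half of the tilted mass where M q is small, since
  elsewhere an error of at most 1 is negligible against M q. Summing over the messages avoids
  conditioning on the sent codeword: the tie-breaking weights of the maximizers add up to 1 and drop
  out, and for fixed y the M codewords are i.i.d. The obvious second-order bound would need
  E[(M q)^2] to be negligible against E[M q], which fails for rates just below R_1 unless V is
  constant. Interpolating to the power 1 + s with small s > 0 reaches every rate below R_1. The
  strict inequality R < I(X;Y) excludes constant V at the critical rate, since its tilted mean would
  be I(X;Y); this is where the positive variance for the central limit theorem comes from.\<close>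

section \<open>Laplace transform of a nonnegative random variable\<close>

lemma exp_le_quadratic:
  fixes x :: real
  assumes "0 \<le> x"
  shows "exp x \<le> 1 + x + x\<^sup>2 * exp x"
proof -
  have "exp x * exp (- x) = 1"
    by (simp flip: exp_add)
  moreover have "exp x * (1 - x) \<le> exp x * exp (- x)"
    using exp_ge_add_one_self[of "- x"] by (intro mult_left_mono) auto
  ultimately have *: "exp x - 1 \<le> x * exp x"
    by (simp add: algebra_simps)
  then have "x * (exp x - 1) \<le> x * (x * exp x)"
    using assms by (intro mult_left_mono)
  with * show ?thesis
    by (simp add: algebra_simps power2_eq_square)
qed

lemma exp_minus_le_quadratic:
  fixes x :: real
  assumes "0 \<le> x"
  shows "exp (- x) \<le> 1 - x + x\<^sup>2"
proof -
  have "exp x * exp (- x) = 1"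
    by (simp flip: exp_add)
  moreover have "(1 + x) * exp (- x) \<le> exp x * exp (- x)"
    using exp_ge_add_one_self[of x] by (intro mult_right_mono) auto
  ultimately have "exp (- x) \<le> 1 - x * exp (- x)"
    by (simp add: algebra_simps)
  moreover have "x * (1 - x) \<le> x * exp (- x)"
    using assms exp_ge_add_one_self[of "- x"] by (intro mult_left_mono) auto
  ultimately show ?thesis
    by (simp add: algebra_simps power2_eq_square)
qed

lemma exp_gt_add_one_self:
  fixes x :: real
  assumes "x \<noteq> 0"
  shows "1 + x < exp x"
  using exp_minus_greater[of "-x"] assms by simp

text \<open>The 8 comes from \<open>exp (x / 2)\<close> \<ge> \<open>(x / 2)^2 / 2\<close>. Sparing
  half of the exponent leaves room for an exponential remainder factor, so second-order terms in V
  are bounded without any moment of V.\<close>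

lemma square_exp_minus_half_le:
  fixes x :: real
  assumes "0 \<le> x"
  shows "x\<^sup>2 * exp (- x / 2) \<le> 8"
proof -
  have "1 + x / 2 + (x / 2)\<^sup>2 / 2 \<le> exp (x / 2)"
    using assms by (intro exp_lower_Taylor_quadratic) auto
  with assms have "x\<^sup>2 \<le> 8 * exp (x / 2)"
    by (simp add: power_divide)
  then have "x\<^sup>2 * exp (- x / 2) \<le> 8 * exp (x / 2) * exp (- x / 2)"
    by (intro mult_right_mono) auto
  also have "\<dots> = 8"
    by (simp flip: exp_add)
  finally show ?thesis .
qed

lemma abs_exp_minus_diff_le:
  fixes x y :: real
  assumes "0 \<le> x" "0 \<le> y"
  shows "\<bar>exp (- x) - exp (- y)\<bar> \<le> \<bar>x - y\<bar>"
proof -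
  have *: "exp (- x) - exp (- y) \<le> y - x" if "0 \<le> x" "x \<le> y" for x y :: real
  proof -
    have "1 - exp (- (y - x)) \<le> y - x"
      using exp_ge_add_one_self[of "- (y - x)"] by linarith
    with that have "exp (- x) * (1 - exp (- (y - x))) \<le> 1 * (y - x)"
      by (intro mult_mono) auto
    moreover have "exp (- x) * exp (- (y - x)) = exp (- y)"
      by (simp flip: exp_add)
    ultimately show ?thesis
      by (simp add: right_diff_distrib)
  qed
  from *[of x y] *[of y x] assms show ?thesis
    by (cases "x \<le> y") auto
qed

text \<open>The channel is hidden behind V = -Z, regarded as a function of the output alone;
  \<open>laplace a\<close> is then the exponential of \<Lambda>(a).\<close>

locale nonneg_random_variable = prob_space M for M :: "'a measure" +
  fixes V :: "'a \<Rightarrow> real"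
  assumes V_measurable [measurable]: "V \<in> borel_measurable M"
    and V_nonneg: "\<And>x. x \<in> space M \<Longrightarrow> 0 \<le> V x"
begin

definition laplace :: "real \<Rightarrow> real" where
  "laplace a = expectation (\<lambda>x. exp (- (a * V x)))"

text \<open>Minus the derivative of \<open>ln (laplace a)\<close> at a = 1, hence the candidate for
  the critical rate.\<close>

definition tilted_mean :: real where
  "tilted_mean = expectation (\<lambda>x. V x * exp (- V x)) / laplace 1"

lemma integrable_exp_minus:
  assumes "0 \<le> a"
  shows "integrable M (\<lambda>x. exp (- (a * V x)))"
  using assms V_nonneg by (intro integrable_const_bound[where B=1] AE_I2) auto

lemma laplace_pos:
  assumes "0 \<le> a"
  shows "0 < laplace a"
proof -
  have "expectation (\<lambda>x. exp (- (a * V x))) \<noteq> 0"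
    using integral_nonneg_eq_0_iff_AE[OF integrable_exp_minus[OF assms]] by simp
  moreover have "0 \<le> expectation (\<lambda>x. exp (- (a * V x)))"
    by simp
  ultimately show ?thesis
    unfolding laplace_def by linarith
qed

lemma laplace_0 [simp]: "laplace 0 = 1"
  by (simp add: laplace_def prob_space)

lemma integrable_square_exp:
  "integrable M (\<lambda>x. (V x)\<^sup>2 * exp (- V x))"
proof (rule integrable_const_bound[where B=8])
  show "AE x in M. norm ((V x)\<^sup>2 * exp (- V x)) \<le> 8"
  proof (rule AE_I2)
    fix x assume "x \<in> space M"
    with V_nonneg have V: "0 \<le> V x" .
    have "(V x)\<^sup>2 * exp (- V x) \<le> (V x)\<^sup>2 * exp (- V x / 2)"
      using V by (intro mult_left_mono) auto
    with square_exp_minus_half_le[OF V] show "norm ((V x)\<^sup>2 * exp (- V x)) \<le> 8"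
      by simp
  qed
qed simp

lemma integrable_mult_exp:
  "integrable M (\<lambda>x. V x * exp (- V x))"
proof (rule Bochner_Integration.integrable_bound)
  show "integrable M (\<lambda>x. (V x)\<^sup>2 * exp (- V x) + exp (- (1 * V x)))"
    by (intro Bochner_Integration.integrable_add integrable_square_exp integrable_exp_minus) simp
  show "AE x in M. norm (V x * exp (- V x)) \<le> norm ((V x)\<^sup>2 * exp (- V x) + exp (- (1 * V x)))"
  proof (rule AE_I2)
    fix x assume "x \<in> space M"
    with V_nonneg have V: "0 \<le> V x" .
    have "0 \<le> (V x - 1)\<^sup>2" "0 \<le> (V x)\<^sup>2"
      by auto
    with V have "V x \<le> (V x)\<^sup>2 + 1"
      unfolding power2_diff by (simp)
    then have "V x * exp (- V x) \<le> ((V x)\<^sup>2 + 1) * exp (- V x)"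
      by (intro mult_right_mono) auto
    with V show "norm (V x * exp (- V x)) \<le> norm ((V x)\<^sup>2 * exp (- V x) + exp (- (1 * V x)))"
      by (simp add: algebra_simps)
  qed
qed simp

lemma tilted_mean_mult: "expectation (\<lambda>x. V x * exp (- V x)) = tilted_mean * laplace 1"
  using laplace_pos[of 1] by (simp add: tilted_mean_def)

text \<open>Tangent bound at 1 for the convex function \<open>ln laplace\<close>. Pointwise, exp u
  \<ge> 1 + u with u = d (V - m), where m is the tilted mean; after weighting by
  \<open>exp (- V)\<close> the linear term integrates to 0. Equality forces u = 0 almost
  surely.\<close>

lemma
  assumes "0 \<le> d" "d \<le> 1"
  shows laplace_ge: "laplace 1 * exp (d * tilted_mean) \<le> laplace (1 - d)"
    and laplace_eqD: "d \<noteq> 0 \<Longrightarrow> laplace (1 - d) = laplace 1 * exp (d * tilted_mean) \<Longrightarrow>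
      AE x in M. V x = tilted_mean"
proof -
  let ?m = tilted_mean
  \<comment> \<open>Expanded into separately integrable terms so that the expectation can be split;
    \<open>g_eq\<close> is the factored form that shows the sign.\<close>
  define g where "g x = exp (- d * ?m) * exp (- ((1 - d) * V x)) - exp (- (1 * V x))
    - d * (V x * exp (- V x)) + d * ?m * exp (- (1 * V x))" for x
  have g_eq: "g x = exp (- V x) * (exp (d * (V x - ?m)) - 1 - d * (V x - ?m))" for x
    by (simp add: g_def algebra_simps flip: exp_add)
  have g_nonneg: "0 \<le> g x" for x
    unfolding g_eq using exp_ge_add_one_self[of "d * (V x - ?m)"] by (intro mult_nonneg_nonneg exp_ge_zero) linarith
  have g_int: "integrable M g"
    unfolding g_def using assms
    by (intro Bochner_Integration.integrable_add Bochner_Integration.integrable_diff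
        integrable_mult_right integrable_exp_minus integrable_mult_exp) auto
  have g_val: "expectation g = exp (- d * ?m) * laplace (1 - d) - laplace 1"
    unfolding g_def using assms
    by (simp add: integrable_exp_minus integrable_exp_minus[of 1, simplified] integrable_mult_exp
        tilted_mean_mult laplace_def[symmetric] laplace_def[of 1, symmetric, simplified])
  have "0 \<le> expectation g"
    using g_nonneg by simp
  then have "laplace 1 * exp (d * ?m) \<le> exp (- d * ?m) * laplace (1 - d) * exp (d * ?m)"
    unfolding g_val by (intro mult_right_mono) auto
  then show "laplace 1 * exp (d * ?m) \<le> laplace (1 - d)"
    by (simp add: mult_ac flip: exp_add)
  assume "d \<noteq> 0" and eq: "laplace (1 - d) = laplace 1 * exp (d * ?m)"
  have "expectation g = 0"
    unfolding g_val eq by (simp add: mult_ac flip: exp_add)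
  then have "AE x in M. g x = 0"
    using integral_nonneg_eq_0_iff_AE[OF g_int] g_nonneg by simp
  then show "AE x in M. V x = ?m"
  proof eventually_elim
    case (elim x)
    then have "exp (d * (V x - ?m)) = 1 + d * (V x - ?m)"
      unfolding g_eq by simp
    with exp_gt_add_one_self[of "d * (V x - ?m)"] \<open>d \<noteq> 0\<close> show ?case
      by fastforce
  qed
qed

text \<open>First-order expansion to the left of 1. For R above the tilted mean the objective a R +
  \<Lambda>(a) decreases strictly when leaving 1, so 1 is not a minimizer.\<close>

lemma laplace_less_above_tilted_mean:
  assumes "tilted_mean < R"
  obtains d where "0 < d" "d < 1" "laplace (1 - d) < laplace 1 * exp (d * R)"
proof -
  \<comment> \<open>The bound 1/2 turns \<open>exp (d * V - V)\<close> into at most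
    \<open>exp (- V / 2)\<close>; the second bound makes the remainder 8 d^2 smaller than the
    first-order gain.\<close>
  define d where "d = min (1 / 2) (laplace 1 * (R - tilted_mean) / 16)"
  have d: "0 < d" "d \<le> 1 / 2" "16 * d \<le> laplace 1 * (R - tilted_mean)"
    using assms laplace_pos[of 1] by (auto simp: d_def)
  have "laplace (1 - d) \<le> expectation (\<lambda>x. exp (- (1 * V x)) + d * (V x * exp (- V x)) + 8 * d\<^sup>2)"
    unfolding laplace_def
  proof (intro integral_mono)
    fix x assume "x \<in> space M"
    with V_nonneg have V: "0 \<le> V x" .
    have "exp (- ((1 - d) * V x)) = exp (- V x) * exp (d * V x)"
      by (simp add: algebra_simps flip: exp_add)
    also have "\<dots> \<le> exp (- V x) * (1 + d * V x + (d * V x)\<^sup>2 * exp (d * V x))"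
      using V d by (intro mult_left_mono exp_le_quadratic) auto
    also have "\<dots> = exp (- V x) + d * (V x * exp (- V x)) + d\<^sup>2 * ((V x)\<^sup>2 * exp (d * V x - V x))"
      by (simp add: algebra_simps exp_diff exp_minus field_simps)
    also have "(V x)\<^sup>2 * exp (d * V x - V x) \<le> (V x)\<^sup>2 * exp (- V x / 2)"
      using d V mult_right_mono[of d "1/2" "V x"] by (intro mult_left_mono) auto
    also have "\<dots> \<le> 8"
      using V by (rule square_exp_minus_half_le)
    finally show "exp (- ((1 - d) * V x)) \<le> exp (- (1 * V x)) + d * (V x * exp (- V x)) + 8 * d\<^sup>2"
      by (simp add: mult_left_mono)
  qed (use d in \<open>auto intro!: integrable_exp_minus integrable_mult_exp Bochner_Integration.integrable_add
        integrable_exp_minus[of 1, simplified]\<close>)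
  also have "\<dots> = laplace 1 + d * (tilted_mean * laplace 1) + 8 * d\<^sup>2"
    by (simp add: integrable_mult_exp integrable_exp_minus[of 1, simplified] tilted_mean_mult prob_space
        laplace_def[of 1, symmetric, simplified])
  also have "8 * d\<^sup>2 < d * (laplace 1 * (R - tilted_mean))"
  proof -
    have "8 * d < laplace 1 * (R - tilted_mean)"
      using d by simp
    with d(1) show ?thesis
      unfolding power2_eq_square mult.left_commute[of 8] by (intro mult_strict_left_mono)
  qed
  also have "laplace 1 + d * (tilted_mean * laplace 1) + d * (laplace 1 * (R - tilted_mean))
      = laplace 1 * (1 + d * R)"
    by (simp add: algebra_simps)
  also have "\<dots> \<le> laplace 1 * exp (d * R)"
    using laplace_pos[of 1] by (intro mult_left_mono exp_ge_add_one_self) auto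
  finally show ?thesis
    using d by (intro that[of d]) auto
qed

text \<open>The same expansion to the right of 1. It is the Chernoff estimate making the moment of M
  q of order 1 + s exponentially smaller than its mean.\<close>

lemma laplace_less_below_tilted_mean:
  assumes "R < tilted_mean"
  obtains s where "0 < s" "s \<le> 1" "exp (s * R) * laplace (1 + s) < laplace 1"
proof -
  \<comment> \<open>The cap 1 keeps the exponent 1 + s at most 2, as the interpolation in
    \<open>tie_error_ge_powr\<close> demands.\<close>
  define s where "s = min 1 (laplace 1 * (tilted_mean - R) / 16)"
  have s: "0 < s" "s \<le> 1" "16 * s \<le> laplace 1 * (tilted_mean - R)"
    using assms laplace_pos[of 1] by (auto simp: s_def)
  have "laplace (1 + s) \<le> expectation (\<lambda>x. exp (- (1 * V x)) - s * (V x * exp (- V x)) + 8 * s\<^sup>2)"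
    unfolding laplace_def
  proof (intro integral_mono)
    fix x assume "x \<in> space M"
    with V_nonneg have V: "0 \<le> V x" .
    have "exp (- ((1 + s) * V x)) = exp (- V x) * exp (- (s * V x))"
      by (simp add: algebra_simps flip: exp_add)
    also have "\<dots> \<le> exp (- V x) * (1 - s * V x + (s * V x)\<^sup>2)"
      using V s by (intro mult_left_mono exp_minus_le_quadratic) auto
    also have "\<dots> = exp (- V x) - s * (V x * exp (- V x)) + s\<^sup>2 * ((V x)\<^sup>2 * exp (- V x))"
      by (simp add: algebra_simps)
    also have "(V x)\<^sup>2 * exp (- V x) \<le> (V x)\<^sup>2 * exp (- V x / 2)"
      using V by (intro mult_left_mono) auto
    also have "\<dots> \<le> 8"
      using V by (rule square_exp_minus_half_le)
    finally show "exp (- ((1 + s) * V x)) \<le> exp (- (1 * V x)) - s * (V x * exp (- V x)) + 8 * s\<^sup>2"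
      by (simp add: mult_left_mono)
  qed (use s in \<open>auto intro!: integrable_exp_minus integrable_mult_exp Bochner_Integration.integrable_add
        Bochner_Integration.integrable_diff integrable_exp_minus[of 1, simplified]\<close>)
  also have "\<dots> = laplace 1 - s * (tilted_mean * laplace 1) + 8 * s\<^sup>2"
    by (simp add: integrable_mult_exp integrable_exp_minus[of 1, simplified] tilted_mean_mult prob_space
        laplace_def[of 1, symmetric, simplified])
  also have "8 * s\<^sup>2 < s * (laplace 1 * (tilted_mean - R))"
  proof -
    have "8 * s < laplace 1 * (tilted_mean - R)"
      using s by simp
    with s(1) show ?thesis
      unfolding power2_eq_square mult.left_commute[of 8] by (intro mult_strict_left_mono)
  qed
  also have "laplace 1 - s * (tilted_mean * laplace 1) + s * (laplace 1 * (tilted_mean - R))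
      = laplace 1 * (1 - s * R)"
    by (simp add: algebra_simps)
  also have "\<dots> \<le> laplace 1 * exp (- (s * R))"
    using laplace_pos[of 1] exp_ge_add_one_self[of "- (s * R)"] by (intro mult_left_mono) auto
  finally have "exp (s * R) * laplace (1 + s) < exp (s * R) * (laplace 1 * exp (- (s * R)))"
    by (intro mult_strict_left_mono) auto
  also have "\<dots> = laplace 1"
    by (simp add: mult_ac flip: exp_add)
  finally show ?thesis
    using s by (intro that[of s]) auto
qed

section \<open>Existence and location of the minimizer\<close>

lemma continuous_on_laplace:
  assumes "integrable M V"
  shows "continuous_on {0..} laplace"
proof (rule lipschitz_on_continuous_on)
  show "(expectation V)-lipschitz_on {0..} laplace"
  proof (rule lipschitz_onI)
    fix a b :: real assume "a \<in> {0..}" "b \<in> {0..}"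
    then have ab: "0 \<le> a" "0 \<le> b" by auto
    have "\<bar>laplace a - laplace b\<bar> = \<bar>expectation (\<lambda>x. exp (- (a * V x)) - exp (- (b * V x)))\<bar>"
      using ab by (simp add: laplace_def integrable_exp_minus)
    also have "\<dots> \<le> expectation (\<lambda>x. \<bar>exp (- (a * V x)) - exp (- (b * V x))\<bar>)"
      by (rule integral_abs_bound)
    also have "\<dots> \<le> expectation (\<lambda>x. V x * \<bar>a - b\<bar>)"
    proof (intro integral_mono)
      fix x assume "x \<in> space M"
      with V_nonneg have V: "0 \<le> V x" .
      have "\<bar>exp (- (a * V x)) - exp (- (b * V x))\<bar> \<le> \<bar>a * V x - b * V x\<bar>"
        using ab V by (intro abs_exp_minus_diff_le) auto
      also have "\<dots> = V x * \<bar>a - b\<bar>"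
        using V by (simp add: abs_mult flip: left_diff_distrib)
      finally show "\<bar>exp (- (a * V x)) - exp (- (b * V x))\<bar> \<le> V x * \<bar>a - b\<bar>" .
    qed (use assms ab in \<open>auto intro!: integrable_abs Bochner_Integration.integrable_diff integrable_exp_minus\<close>)
    finally show "dist (laplace a) (laplace b) \<le> expectation V * dist a b"
      using assms by (simp add: dist_real_def)
  qed (use V_nonneg in auto)
qed

text \<open>The right derivative of \<open>laplace\<close> at 0 is minus the mean of V, by dominated
  convergence of the difference quotients with V as the majorant. So the objective is negative
  somewhere to the right of 0.\<close>

lemma laplace_less_below_mean:
  assumes "integrable M V" "R < expectation V"
  obtains a where "0 < a" "a \<le> 1" "laplace a < exp (- (a * R))"
proof -
  define a where "a k = 1 / real (Suc k)" for k
  have a: "0 < a k" "a k \<le> 1" for k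
    by (auto simp: a_def)
  have a_lim: "a \<longlonglongrightarrow> 0"
    unfolding a_def by (rule LIMSEQ_Suc[OF lim_1_over_n])
  have "(\<lambda>k. expectation (\<lambda>x. (1 - exp (- (a k * V x))) / a k)) \<longlonglongrightarrow> expectation V"
  proof (rule integral_dominated_convergence[where w=V])
    show "AE x in M. (\<lambda>k. (1 - exp (- (a k * V x))) / a k) \<longlonglongrightarrow> V x"
    proof (rule AE_I2)
      fix x
      have "((\<lambda>t. (1 - exp (- (t * V x))) / t) \<longlongrightarrow> V x) (at_right 0)"
        by real_asymp
      moreover have "filterlim a (at_right 0) sequentially"
        using a_lim a by (auto simp: filterlim_at a_def)
      ultimately show "(\<lambda>k. (1 - exp (- (a k * V x))) / a k) \<longlonglongrightarrow> V x"
        by (rule filterlim_compose)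
    qed
    show "AE x in M. norm ((1 - exp (- (a k * V x))) / a k) \<le> V x" for k
    proof (rule AE_I2)
      fix x assume "x \<in> space M"
      with V_nonneg have V: "0 \<le> V x" .
      have "\<bar>exp (- 0) - exp (- (a k * V x))\<bar> \<le> \<bar>0 - a k * V x\<bar>"
        using a[of k] V by (intro abs_exp_minus_diff_le) auto
      with a[of k] V show "norm ((1 - exp (- (a k * V x))) / a k) \<le> V x"
        by (simp add: field_simps abs_mult)
    qed
  qed (use assms in auto)
  then have "eventually (\<lambda>k. R < expectation (\<lambda>x. (1 - exp (- (a k * V x))) / a k)) sequentially"
    using assms(2) by (rule order_tendstoD)
  then obtain k where "R < expectation (\<lambda>x. (1 - exp (- (a k * V x))) / a k)"
    by (auto simp: eventually_at_top_linorder)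
  also have "\<dots> = (1 - laplace (a k)) / a k"
    using a[of k] by (simp add: laplace_def integrable_exp_minus prob_space)
  finally have "laplace (a k) < 1 + - (a k * R)"
    using a[of k] by (simp add: field_simps)
  also have "\<dots> \<le> exp (- (a k * R))"
    by (rule exp_ge_add_one_self)
  finally show ?thesis
    using a[of k] that by blast
qed

text \<open>The range (0,1] is not compact, so the minimum is taken over [0,1]; there the value at 0
  is 0, and a point with negative value excludes it.\<close>

lemma exists_minimizer:
  assumes "integrable M V" "R < expectation V"
  obtains a where "0 < a" "a \<le> 1"
    "\<And>b. 0 < b \<Longrightarrow> b \<le> 1 \<Longrightarrow> a * R + ln (laplace a) \<le> b * R + ln (laplace b)"
proof -
  let ?g = "\<lambda>a. a * R + ln (laplace a)"
  have "continuous_on {0..1} laplace"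
    using continuous_on_laplace[OF assms(1)] by (rule continuous_on_subset) auto
  then have "continuous_on {0..1} ?g"
    using laplace_pos by (intro continuous_intros) (auto simp: less_imp_neq[symmetric])
  then obtain a where a: "a \<in> {0..1}" "\<And>b. b \<in> {0..1} \<Longrightarrow> ?g a \<le> ?g b"
    using continuous_attains_inf[of "{0..1::real}" ?g] by auto
  obtain b where b: "0 < b" "b \<le> 1" "laplace b < exp (- (b * R))"
    using laplace_less_below_mean[OF assms] .
  have "ln (laplace b) < ln (exp (- (b * R)))"
    using b laplace_pos[of b] by (subst ln_less_cancel_iff) auto
  then have "?g b < 0"
    by simp
  with a(2)[of b] b have "?g a < 0"
    by simp
  then have "a \<noteq> 0"
    by auto
  with a that[of a] show ?thesis
    by auto
qed

text \<open>Both parts compare the slope -R with the tangent at 1. Strictness matters because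
  \<open>rho\<close> is an arbitrary choice among the minimizers: only uniqueness identifies
  it.\<close>

lemma minimum_at_1:
  assumes "0 < a" "a \<le> 1" "R \<le> tilted_mean"
  shows "R + ln (laplace 1) \<le> a * R + ln (laplace a)"
    and "a \<noteq> 1 \<Longrightarrow> R < tilted_mean \<or> \<not> (AE x in M. V x = tilted_mean) \<Longrightarrow>
      R + ln (laplace 1) < a * R + ln (laplace a)"
proof -
  let ?m = tilted_mean
  have pos: "0 < laplace 1" "0 < laplace a"
    using assms laplace_pos by auto
  have ln: "ln (laplace 1 * exp ((1 - a) * ?m)) = ln (laplace 1) + (1 - a) * ?m"
    using pos by (simp add: ln_mult)
  have le: "laplace 1 * exp ((1 - a) * ?m) \<le> laplace a"
    using assms laplace_ge[of "1 - a"] by simp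
  have ln_le: "ln (laplace 1) + (1 - a) * ?m \<le> ln (laplace a)"
    unfolding ln[symmetric] using le pos by (subst ln_le_cancel_iff) auto
  have R_le: "(1 - a) * R \<le> (1 - a) * ?m"
    using assms by (intro mult_left_mono) auto
  show "R + ln (laplace 1) \<le> a * R + ln (laplace a)"
    using ln_le R_le by (simp add: algebra_simps)
  assume "a \<noteq> 1" and "R < ?m \<or> \<not> (AE x in M. V x = ?m)"
  then consider "R < ?m" | "\<not> (AE x in M. V x = ?m)"
    by blast
  then show "R + ln (laplace 1) < a * R + ln (laplace a)"
  proof cases
    case 1
    then have "(1 - a) * R < (1 - a) * ?m"
      using assms \<open>a \<noteq> 1\<close> by (intro mult_strict_left_mono) auto
    with ln_le show ?thesis
      by (simp add: algebra_simps)
  next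
    case 2
    then have "laplace a \<noteq> laplace 1 * exp ((1 - a) * ?m)"
      using laplace_eqD[of "1 - a"] assms \<open>a \<noteq> 1\<close> by auto
    with le have "laplace 1 * exp ((1 - a) * ?m) < laplace a"
      by simp
    then have "ln (laplace 1) + (1 - a) * ?m < ln (laplace a)"
      unfolding ln[symmetric] using pos by (subst ln_less_cancel_iff) auto
    with R_le show ?thesis
      by (simp add: algebra_simps)
  qed
qed

end


section \<open>Products, the normal distribution, and random tie breaking\<close>

text \<open>Both measures are compared on boxes, where the density integral factors by
  Tonelli.\<close>

lemma PiM_density:
  fixes Q :: "'a measure" and f :: "'i \<Rightarrow> 'a \<Rightarrow> ennreal"
  assumes I: "finite I" and Q: "sigma_finite_measure Q"
    and f [measurable]: "\<And>i. i \<in> I \<Longrightarrow> f i \<in> borel_measurable Q"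
    and sf: "\<And>i. i \<in> I \<Longrightarrow> sigma_finite_measure (density Q (f i))"
  shows "(\<Pi>\<^sub>M i\<in>I. density Q (f i)) = density (\<Pi>\<^sub>M i\<in>I. Q) (\<lambda>y. \<Prod>i\<in>I. f i (y i))"
proof -
  \<comment> \<open>\<open>product_sigma_finite\<close> speaks about every index, also those outside
    I, so the family is completed by Q there.\<close>
  define D where "D i = (if i \<in> I then density Q (f i) else Q)" for i
  interpret D: product_sigma_finite D
    using Q sf by (auto simp: product_sigma_finite_def D_def)
  interpret Q: product_sigma_finite "\<lambda>_::'i. Q"
    using Q by (auto simp: product_sigma_finite_def)
  have "(\<Pi>\<^sub>M i\<in>I. density Q (f i)) = PiM I D"
    by (intro PiM_cong) (auto simp: D_def)
  also have "\<dots> = density (\<Pi>\<^sub>M i\<in>I. Q) (\<lambda>y. \<Prod>i\<in>I. f i (y i))"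
  proof (rule D.PiM_eqI[symmetric])
    show "finite I" by fact
    show "sets (density (\<Pi>\<^sub>M i\<in>I. Q) (\<lambda>y. \<Prod>i\<in>I. f i (y i))) = sets (PiM I D)"
      by (simp, intro sets_PiM_cong) (auto simp: D_def)
    fix A assume "\<And>i. i \<in> I \<Longrightarrow> A i \<in> sets (D i)"
    then have A [measurable]: "\<And>i. i \<in> I \<Longrightarrow> A i \<in> sets Q"
      by (auto simp: D_def)
    have ind: "indicator (Pi\<^sub>E I A) y = (\<Prod>i\<in>I. indicator (A i) (y i) :: ennreal)"
      if "y \<in> space (\<Pi>\<^sub>M i\<in>I. Q)" for y
    proof (cases "y \<in> Pi\<^sub>E I A")
      case True
      then have "(\<Prod>i\<in>I. indicator (A i) (y i) :: ennreal) = (\<Prod>i\<in>I. 1)"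
        by (intro prod.cong) (auto simp: PiE_iff)
      with True show ?thesis by simp
    next
      case False
      with that obtain i where "i \<in> I" "y i \<notin> A i"
        by (auto simp: space_PiM PiE_iff)
      with I have "(\<Prod>i\<in>I. indicator (A i) (y i) :: ennreal) = 0"
        by (intro prod_zero) (auto intro!: bexI[of _ i])
      with False show ?thesis by simp
    qed
    have "emeasure (density (\<Pi>\<^sub>M i\<in>I. Q) (\<lambda>y. \<Prod>i\<in>I. f i (y i))) (Pi\<^sub>E I A)
        = (\<integral>\<^sup>+y. (\<Prod>i\<in>I. f i (y i)) * indicator (Pi\<^sub>E I A) y \<partial>(\<Pi>\<^sub>M i\<in>I. Q))"
      using I by (intro emeasure_density) (auto intro!: sets_PiM_I_finite)
    also have "\<dots> = (\<integral>\<^sup>+y. (\<Prod>i\<in>I. f i (y i) * indicator (A i) (y i)) \<partial>(\<Pi>\<^sub>M i\<in>I. Q))"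
      by (intro nn_integral_cong) (simp add: ind prod.distrib)
    also have "\<dots> = (\<Prod>i\<in>I. \<integral>\<^sup>+y. f i y * indicator (A i) y \<partial>Q)"
      using I by (intro Q.product_nn_integral_prod) auto
    also have "\<dots> = (\<Prod>i\<in>I. emeasure (D i) (A i))"
      by (intro prod.cong refl) (simp add: D_def emeasure_density)
    finally show "emeasure (density (\<Pi>\<^sub>M i\<in>I. Q) (\<lambda>y. \<Prod>i\<in>I. f i (y i))) (Pi\<^sub>E I A)
        = (\<Prod>i\<in>I. emeasure (D i) (A i))" .
  qed
  finally show ?thesis .
qed

lemma (in prob_space) indep_vars_PiM_coordinates:
  "prob_space.indep_vars (\<Pi>\<^sub>M i\<in>(UNIV :: 'i set). M) (\<lambda>_. M) (\<lambda>i \<omega>. \<omega> i) UNIV"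
proof -
  interpret U: product_prob_space "\<lambda>_::'i. M" UNIV
    by (rule product_prob_spaceI) (rule prob_space_axioms)
  have "distr (\<Pi>\<^sub>M i\<in>(UNIV :: 'i set). M) (\<Pi>\<^sub>M i\<in>UNIV. M) (\<lambda>x. \<lambda>i\<in>UNIV. x i) =
      (\<Pi>\<^sub>M i\<in>UNIV. distr (\<Pi>\<^sub>M i\<in>(UNIV :: 'i set). M) M (\<lambda>x. x i))"
    by (simp add: U.PiM_component restrict_UNIV distr_id)
  then show ?thesis
    by (subst U.indep_vars_iff_distr_eq_PiM') auto
qed

text \<open>Absence of atoms gives continuity. Reflection gives the two half-lines equal mass, and
  their overlap is the null set {0}. This 1/2 is what turns the constant 1/2 into 1/4.\<close>

lemma
  shows isCont_cdf_std_normal: "isCont (cdf std_normal_distribution) x"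
    and cdf_std_normal_0: "cdf std_normal_distribution 0 = 1 / 2"
proof -
  interpret N: real_distribution std_normal_distribution
    by (rule real_dist_normal_dist)
  have null: "emeasure std_normal_distribution {x} = 0" for x
    by (subst emeasure_density) (auto simp: nn_integral_0_iff_AE intro: AE_mp[OF AE_lborel_singleton[of x]])
  then show "isCont (cdf std_normal_distribution) x"
    by (simp add: N.isCont_cdf measure_def)
  have "emeasure std_normal_distribution {0..} = emeasure std_normal_distribution {..0}"
  proof -
    have "emeasure std_normal_distribution {0..} =
        (\<integral>\<^sup>+x. ennreal (std_normal_density x) * indicator {0..} x \<partial>lborel)"
      by (subst emeasure_density) auto
    also have "\<dots> = (\<integral>\<^sup>+x. ennreal (std_normal_density (- x)) * indicator {0..} (- x) \<partial>lborel)"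
      by (subst nn_integral_real_affine[where c="-1" and t=0]) auto
    also have "\<dots> = (\<integral>\<^sup>+x. ennreal (std_normal_density x) * indicator {..0} x \<partial>lborel)"
      by (intro nn_integral_cong) (auto simp: std_normal_density_def indicator_def)
    also have "\<dots> = emeasure std_normal_distribution {..0}"
      by (subst emeasure_density) auto
    finally show ?thesis .
  qed
  then have eq: "N.prob {0..} = N.prob {..0}"
    by (simp add: measure_def)
  have "N.prob ({..0} \<union> {0..}) = N.prob {..0} + N.prob {0..} - N.prob ({..0} \<inter> {0..})"
    by (subst N.finite_measure_Union') (auto simp: N.finite_measure_Diff' Int_commute)
  moreover have "{..0} \<union> {0..} = (UNIV :: real set)" "{..0} \<inter> {0..} = {0 :: real}"
    by auto
  moreover have "N.prob UNIV = 1"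
    using N.prob_space by simp
  ultimately show "cdf std_normal_distribution 0 = 1 / 2"
    using eq null[of 0] by (simp add: cdf_def measure_def)
qed

text \<open>With N competitors tying, N binomial with parameters K - 1 and q, uniform tie-breaking
  errs with probability 1 - E[1 / (1 + N)]; this is its closed form.\<close>

definition tie_error :: "nat \<Rightarrow> real \<Rightarrow> real" where
  "tie_error K q = 1 - (1 - (1 - q) ^ K) / (real K * q)"

text \<open>The geometric sum removes q from the denominator, so every later bound follows from a
  bound on the single powers (1 - q)^k.\<close>

lemma tie_error_eq_sum:
  assumes "0 < q" "0 < K"
  shows "tie_error K q = 1 - (\<Sum>k<K. (1 - q) ^ k) / real K"
proof -
  have "1 - (1 - q) ^ K = q * (\<Sum>k<K. (1 - q) ^ k)"
    using one_diff_power_eq[of "1 - q" K] by simp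
  with assms show ?thesis
    by (simp add: tie_error_def)
qed

lemma sum_mult_lessThan_real: "(\<Sum>k<n. real k * q) = real n * (real n - 1) / 2 * q"
  by (induction n) (auto simp: field_simps)

context
  fixes q :: real and K :: nat
  assumes q: "0 < q" "q \<le> 1" and K: "0 < K"
begin

lemma tie_error_le_1: "tie_error K q \<le> 1"
  using q K by (simp add: tie_error_eq_sum sum_nonneg)

lemma tie_error_nonneg: "0 \<le> tie_error K q"
proof -
  have "(\<Sum>k<K. (1 - q) ^ k) \<le> (\<Sum>k<K. 1)"
    using q by (intro sum_mono power_le_one) auto
  with q K show ?thesis
    by (simp add: tie_error_eq_sum)
qed

text \<open>Bernoulli's inequality in each term. Keeping K - 1, the number of competitors, pays off
  because K - 1 \<le> \<open>exp (n * R)\<close>: the normalised error is then at most 1/2 for every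
  n.\<close>

lemma tie_error_le: "tie_error K q \<le> (real K - 1) * q / 2"
proof -
  have "(\<Sum>k<K. 1 - real k * q) \<le> (\<Sum>k<K. (1 - q) ^ k)"
    using q Bernoulli_inequality[of "- q"] by (intro sum_mono) simp
  also have "(\<Sum>k<K. 1 - real k * q) = real K * (1 - (real K - 1) * q / 2)"
    unfolding sum_subtractf sum_mult_lessThan_real by (simp add: field_simps)
  finally have "1 - (real K - 1) * q / 2 \<le> (\<Sum>k<K. (1 - q) ^ k) / real K"
    using K by (subst pos_le_divide_eq) (auto simp: mult.commute)
  with q K show ?thesis
    by (simp add: tie_error_eq_sum)
qed

lemma tie_error_ge_quadratic: "(real K - 1) * q / 2 - (real K * q)\<^sup>2 \<le> tie_error K q"
proof -
  have "(\<Sum>k<K. (1 - q) ^ k) \<le> (\<Sum>k<K. 1 - real k * q + (real K * q)\<^sup>2)"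
  proof (intro sum_mono)
    fix k assume "k \<in> {..<K}"
    have "(1 - q) ^ k \<le> exp (- q) ^ k"
      using q exp_ge_add_one_self[of "- q"] by (intro power_mono) auto
    also have "\<dots> = exp (- (real k * q))"
      by (simp flip: exp_of_nat_mult)
    also have "\<dots> \<le> 1 - real k * q + (real k * q)\<^sup>2"
      using q by (intro exp_minus_le_quadratic) auto
    also have "(real k * q)\<^sup>2 \<le> (real K * q)\<^sup>2"
      using q \<open>k \<in> {..<K}\<close> by (intro power_mono mult_right_mono) auto
    finally show "(1 - q) ^ k \<le> 1 - real k * q + (real K * q)\<^sup>2"
      by simp
  qed
  also have "\<dots> = real K * (1 - (real K - 1) * q / 2 + (real K * q)\<^sup>2)"
    unfolding sum_subtractf sum.distrib sum_mult_lessThan_real by (simp add: field_simps)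
  finally have "(\<Sum>k<K. (1 - q) ^ k) / real K \<le> 1 - (real K - 1) * q / 2 + (real K * q)\<^sup>2"
    using K by (subst pos_divide_le_eq) (auto simp: mult.commute)
  with q K show ?thesis
    by (simp add: tie_error_eq_sum)
qed

text \<open>For K q \<le> 1 the square is dominated by the smaller power 1 + s; for K q > 1 the
  left-hand side is not positive. A small s lets the Chernoff estimate apply at every rate below the
  tilted mean.\<close>

lemma tie_error_ge_powr:
  assumes s: "0 \<le> s" "s \<le> 1"
  shows "(real K - 1) * q / 2 - (real K * q) powr (1 + s) \<le> tie_error K q"
proof (cases "real K * q \<le> 1")
  case True
  have "(real K * q)\<^sup>2 = (real K * q) powr 2"
    using q K by simp
  also have "\<dots> \<le> (real K * q) powr (1 + s)"
    using True q K s by (intro powr_mono') auto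
  finally show ?thesis
    using tie_error_ge_quadratic by simp
next
  case False
  have "(real K - 1) * q / 2 \<le> (real K * q) powr 1"
    using q K by (simp add: algebra_simps)
  also have "\<dots> \<le> (real K * q) powr (1 + s)"
    using False s by (intro powr_mono) auto
  finally show ?thesis
    using tie_error_nonneg by simp
qed

end

lemma borel_measurable_tie_error [measurable]: "tie_error K \<in> borel_measurable borel"
  unfolding tie_error_def [abs_def] by measurable


section \<open>Expected error for i.i.d. information densities\<close>

context nonneg_random_variable
begin

definition expected_tie_error :: "(nat \<Rightarrow> nat) \<Rightarrow> nat \<Rightarrow> real" where
  "expected_tie_error K n =
     (\<integral>y. tie_error (K n) (exp (- (\<Sum>i<n. V (y i)))) \<partial>(\<Pi>\<^sub>M i\<in>{..<n}. M))"

lemma sum_V_measurable [measurable]: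
  "(\<lambda>y. \<Sum>i<n. V (y i)) \<in> borel_measurable (\<Pi>\<^sub>M i\<in>{..<n}. M)"
  by measurable

lemma sum_V_nonneg:
  assumes "y \<in> space (\<Pi>\<^sub>M i\<in>{..<n}. M)"
  shows "0 \<le> (\<Sum>i<n. V (y i))"
  using assms V_nonneg by (auto simp: space_PiM PiE_iff intro!: sum_nonneg)

lemma
  fixes n :: nat
  assumes "0 \<le> a"
  shows integrable_exp_sum: "integrable (\<Pi>\<^sub>M i\<in>{..<n}. M) (\<lambda>y. exp (- (a * (\<Sum>i<n. V (y i)))))"
    and integral_exp_sum:
      "(\<integral>y. exp (- (a * (\<Sum>i<n. V (y i)))) \<partial>(\<Pi>\<^sub>M i\<in>{..<n}. M)) = laplace a ^ n"
proof -
  interpret P: product_prob_space "\<lambda>_::nat. M" "{..<n}"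
    by (rule product_prob_spaceI) (rule prob_space_axioms)
  have eq: "exp (- (a * (\<Sum>i<n. V (y i)))) = (\<Prod>i<n. exp (- (a * V (y i))))" for y
    by (simp add: sum_distrib_left exp_sum flip: sum_negf)
  show "integrable (\<Pi>\<^sub>M i\<in>{..<n}. M) (\<lambda>y. exp (- (a * (\<Sum>i<n. V (y i)))))"
    unfolding eq by (intro P.product_integrable_prod integrable_exp_minus assms) auto
  show "(\<integral>y. exp (- (a * (\<Sum>i<n. V (y i)))) \<partial>(\<Pi>\<^sub>M i\<in>{..<n}. M)) = laplace a ^ n"
    unfolding eq
    by (subst P.product_integral_prod) (auto intro: integrable_exp_minus assms simp: laplace_def)
qed

lemma integrable_tie_error:
  fixes n :: nat
  assumes "0 < K"
  shows "integrable (\<Pi>\<^sub>M i\<in>{..<n}. M) (\<lambda>y. tie_error K (exp (- (\<Sum>i<n. V (y i)))))"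
proof -
  interpret P: finite_product_prob_space "\<lambda>_::nat. M" "{..<n}"
    by standard auto
  show ?thesis
  proof (intro P.integrable_const_bound[where B=1] AE_I2)
    fix y assume "y \<in> space (\<Pi>\<^sub>M i\<in>{..<n}. M)"
    then have "exp (- (\<Sum>i<n. V (y i))) \<le> 1"
      using sum_V_nonneg by simp
    from tie_error_nonneg[OF _ this assms] tie_error_le_1[OF _ this assms]
    show "norm (tie_error K (exp (- (\<Sum>i<n. V (y i))))) \<le> 1"
      by simp
  qed measurable
qed

section \<open>Rates below the tilted mean\<close>

context
  fixes R :: real and K :: "nat \<Rightarrow> nat"
  assumes R: "0 < R"
    and K_ge: "\<And>n. exp (real n * R) \<le> real (K n)"
    and K_le: "\<And>n. real (K n) \<le> exp (real n * R) + 1"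
begin

lemma K_pos: "0 < K n"
  using K_ge[of n] exp_gt_zero[of "real n * R"] by (metis less_le_trans of_nat_0_less_iff)

lemma K_le_double: "real (K n) \<le> 2 * exp (real n * R)"
proof -
  have "1 \<le> exp (real n * R)"
    using R by simp
  with K_le[of n] show ?thesis
    by linarith
qed

text \<open>The linear part of the tie error integrates exactly to half of the normaliser, up to
  rounding of K; the correction of order 1 + s decays geometrically relative to it.\<close>

lemma expected_tie_error_below_tilted_mean:
  assumes R_less: "R < tilted_mean"
  shows "(\<lambda>n. expected_tie_error K n / (exp (real n * R) * laplace 1 ^ n)) \<longlonglongrightarrow> 1 / 2"
proof -
  obtain s where s: "0 < s" "s \<le> 1" "exp (s * R) * laplace (1 + s) < laplace 1"
    using laplace_less_below_tilted_mean[OF R_less] .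
  \<comment> \<open>The factor per letter between the moment of order 1 + s of
    \<open>exp (n * R)\<close> q and its mean. The 4 that appears below bounds 2^(1 + s), from K
    \<le> 2 \<open>exp (n * R)\<close>.\<close>
  define r where "r = exp (s * R) * laplace (1 + s) / laplace 1"
  have pos: "0 < laplace 1" "0 < laplace (1 + s)"
    using laplace_pos s by auto
  have r: "0 \<le> r" "r < 1"
    using s pos by (auto simp: r_def)
  have upper: "expected_tie_error K n / (exp (real n * R) * laplace 1 ^ n) \<le> 1 / 2" for n
  proof -
    have "expected_tie_error K n \<le> (\<integral>y. (real (K n) - 1) / 2 * exp (- (1 * (\<Sum>i<n. V (y i)))) \<partial>(\<Pi>\<^sub>M i\<in>{..<n}. M))"
      unfolding expected_tie_error_def
      using tie_error_le[of "exp (- (\<Sum>i<n. V (y i)))" "K n" for y] sum_V_nonneg K_pos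
      by (intro integral_mono integrable_tie_error integrable_mult_right integrable_exp_sum) auto
    also have "\<dots> = (real (K n) - 1) / 2 * laplace 1 ^ n"
      by (subst Bochner_Integration.integral_mult_right_zero) (simp only: integral_exp_sum[OF zero_le_one])
    also have "\<dots> \<le> exp (real n * R) / 2 * laplace 1 ^ n"
      using K_le[of n] pos by (intro mult_right_mono) auto
    finally show ?thesis
      using pos by (simp add: field_simps)
  qed
  have lower: "(1 - exp (- (real n * R))) / 2 - 4 * r ^ n
      \<le> expected_tie_error K n / (exp (real n * R) * laplace 1 ^ n)" for n
  proof -
    let ?E = "exp (real n * R)"
    have powr_le: "real (K n) powr (1 + s) \<le> 4 * (?E * exp (s * R) ^ n)"
    proof -
      have "real (K n) powr (1 + s) \<le> (2 * ?E) powr (1 + s)"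
        using K_le_double s by (intro powr_mono2) auto
      also have "\<dots> = 2 powr (1 + s) * (?E * exp (s * R) ^ n)"
        by (simp add: powr_mult powr_def[of "exp _"] algebra_simps exp_add flip: exp_of_nat_mult)
      also have "2 powr (1 + s) \<le> (2::real) powr 2"
        using s by (intro powr_mono) auto
      finally show ?thesis
        by (simp add: mult_right_mono)
    qed
    have "(1 - exp (- (real n * R))) / 2 - 4 * r ^ n =
        ((?E - 1) / 2 * laplace 1 ^ n - 4 * (?E * exp (s * R) ^ n) * laplace (1 + s) ^ n) / (?E * laplace 1 ^ n)"
      using pos by (simp add: r_def field_simps power_mult_distrib power_divide exp_minus)
    also have "\<dots> \<le> expected_tie_error K n / (?E * laplace 1 ^ n)"
    proof (intro divide_right_mono)
      have "(?E - 1) / 2 * laplace 1 ^ n - 4 * (?E * exp (s * R) ^ n) * laplace (1 + s) ^ n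
          \<le> (real (K n) - 1) / 2 * laplace 1 ^ n - real (K n) powr (1 + s) * laplace (1 + s) ^ n"
        using K_ge[of n] powr_le pos by (intro diff_mono mult_right_mono) auto
      also have "\<dots> = (\<integral>y. (real (K n) - 1) / 2 * exp (- (1 * (\<Sum>i<n. V (y i))))
          - real (K n) powr (1 + s) * exp (- ((1 + s) * (\<Sum>i<n. V (y i)))) \<partial>(\<Pi>\<^sub>M i\<in>{..<n}. M))"
        using s
        by (subst Bochner_Integration.integral_diff)
          (auto simp only: integral_exp_sum[of "1 + s"] integral_exp_sum[OF zero_le_one]
            Bochner_Integration.integral_mult_right_zero
            intro!: integrable_mult_right integrable_exp_sum)
      also have "\<dots> \<le> expected_tie_error K n"
        unfolding expected_tie_error_def
      proof (intro integral_mono)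
        fix y assume y: "y \<in> space (\<Pi>\<^sub>M i\<in>{..<n}. M)"
        define q where "q = exp (- (\<Sum>i<n. V (y i)))"
        have q: "0 < q" "q \<le> 1"
          using sum_V_nonneg[OF y] by (auto simp: q_def)
        have "exp (- ((1 + s) * (\<Sum>i<n. V (y i)))) = q powr (1 + s)"
          by (simp add: q_def powr_def)
        with tie_error_ge_powr[OF q K_pos[of n], of s] s q
        show "(real (K n) - 1) / 2 * exp (- (1 * (\<Sum>i<n. V (y i))))
            - real (K n) powr (1 + s) * exp (- ((1 + s) * (\<Sum>i<n. V (y i)))) \<le> tie_error (K n) q"
          by (simp add: powr_mult q_def[symmetric])
      qed (use s K_pos in \<open>intro integrable_tie_error integrable_mult_right
          Bochner_Integration.integrable_diff integrable_exp_sum; simp\<close>)+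
      finally show "(?E - 1) / 2 * laplace 1 ^ n - 4 * (?E * exp (s * R) ^ n) * laplace (1 + s) ^ n
          \<le> expected_tie_error K n" .
    qed (use pos in auto)
    finally show ?thesis .
  qed
  show ?thesis
  proof (rule tendsto_sandwich)
    have "(\<lambda>n. exp (- (real n * R))) \<longlonglongrightarrow> 0"
      using R by real_asymp
    moreover have "(\<lambda>n. r ^ n) \<longlonglongrightarrow> 0"
      using r by (intro LIMSEQ_power_zero) auto
    ultimately have "(\<lambda>n. (1 - exp (- (real n * R))) / 2 - 4 * r ^ n) \<longlonglongrightarrow> (1 - 0) / 2 - 4 * 0"
      by (intro tendsto_diff tendsto_divide tendsto_mult tendsto_const) auto
    then show "(\<lambda>n. (1 - exp (- (real n * R))) / 2 - 4 * r ^ n) \<longlonglongrightarrow> 1 / 2"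
      by simp
  qed (use lower upper in auto)
qed

section \<open>The critical rate: change of measure and central limit theorem\<close>

definition tilted_measure :: "'a measure" where
  "tilted_measure = density M (\<lambda>x. ennreal (exp (- V x) / laplace 1))"

lemma sets_tilted_measure [measurable_cong]: "sets tilted_measure = sets M"
  by (simp add: tilted_measure_def)

lemma
  fixes f :: "'a \<Rightarrow> real"
  assumes [measurable]: "f \<in> borel_measurable M"
  shows integral_tilted_measure:
      "(\<integral>x. f x \<partial>tilted_measure) = expectation (\<lambda>x. f x * exp (- V x)) / laplace 1"
    and integrable_tilted_measure:
      "integrable M (\<lambda>x. f x * exp (- V x)) \<Longrightarrow> integrable tilted_measure f"
proof -
  have "0 < laplace 1"
    by (simp add: laplace_pos)
  then show "(\<integral>x. f x \<partial>tilted_measure) = expectation (\<lambda>x. f x * exp (- V x)) / laplace 1"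
    and "integrable M (\<lambda>x. f x * exp (- V x)) \<Longrightarrow> integrable tilted_measure f"
    unfolding tilted_measure_def
    by (simp_all add: integral_density integrable_density mult.commute)
qed

lemma AE_tilted_measure:
  "(AE x in tilted_measure. A x) \<longleftrightarrow> (AE x in M. A x)"
  using laplace_pos[of 1] unfolding tilted_measure_def
  by (subst AE_density) (auto simp: ennreal_zero_less_divide intro!: AE_cong)

lemma prob_space_tilted_measure: "prob_space tilted_measure"
proof
  have "emeasure tilted_measure (space tilted_measure)
      = (\<integral>\<^sup>+x. ennreal (exp (- V x) / laplace 1) \<partial>M)"
    unfolding tilted_measure_def by (subst emeasure_density) (auto intro!: nn_integral_cong)
  also have "\<dots> = ennreal (expectation (\<lambda>x. exp (- V x) / laplace 1))"
    using integrable_exp_minus[of 1] laplace_pos[of 1]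
    by (intro nn_integral_eq_integral) auto
  also have "\<dots> = 1"
    using laplace_pos[of 1] by (simp add: laplace_def)
  finally show "emeasure tilted_measure (space tilted_measure) = 1" .
qed

text \<open>Undoing the tilt costs \<open>laplace 1 * exp (V x)\<close> per letter. The infinite
  product provides one probability space for all n, on which the normalised sums of the central
  limit theorem live; the integrand sees only its first n coordinates.\<close>

lemma expected_tie_error_tilted:
  "expected_tie_error K n = laplace 1 ^ n *
     (\<integral>\<omega>. tie_error (K n) (exp (- (\<Sum>i<n. V (\<omega> i)))) * exp (\<Sum>i<n. V (\<omega> i))
        \<partial>(\<Pi>\<^sub>M i\<in>(UNIV :: nat set). tilted_measure))"
proof -
  interpret T: prob_space tilted_measure
    by (rule prob_space_tilted_measure)
  interpret U: product_prob_space "\<lambda>_::nat. tilted_measure" UNIV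
    by (rule product_prob_spaceI) (rule prob_space_tilted_measure)
  let ?c = "laplace 1"
  have pos: "0 < ?c"
    by (simp add: laplace_pos)
  have [measurable]: "(\<lambda>y. \<Sum>i<n. V (y i)) \<in> borel_measurable (\<Pi>\<^sub>M i\<in>{..<n}. tilted_measure)"
    by (intro borel_measurable_sum measurable_compose[OF measurable_component_singleton]) auto
  let ?F = "\<lambda>y::nat \<Rightarrow> 'a. tie_error (K n) (exp (- (\<Sum>i<n. V (y i)))) * exp (\<Sum>i<n. V (y i))"
  have dens: "(\<Pi>\<^sub>M i\<in>{..<n}. tilted_measure) =
      density (\<Pi>\<^sub>M i\<in>{..<n}. M) (\<lambda>y. ennreal (\<Prod>i<n. exp (- V (y i)) / ?c))"
    unfolding tilted_measure_def using pos
    by (subst PiM_density) (auto simp: prod_ennreal sigma_finite_measure_axioms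
        tilted_measure_def[symmetric] T.sigma_finite_measure_axioms)
  have "(\<integral>\<omega>. ?F \<omega> \<partial>(\<Pi>\<^sub>M i\<in>UNIV. tilted_measure)) =
      (\<integral>\<omega>. ?F (restrict \<omega> {..<n}) \<partial>(\<Pi>\<^sub>M i\<in>UNIV. tilted_measure))"
    by (intro Bochner_Integration.integral_cong refl) simp
  also have "\<dots> = (\<integral>y. ?F y \<partial>(\<Pi>\<^sub>M i\<in>{..<n}. tilted_measure))"
    by (subst U.distr_PiM_restrict_finite[symmetric]) (auto simp: integral_distr)
  also have "\<dots> = (\<integral>y. (\<Prod>i<n. exp (- V (y i)) / ?c) * ?F y \<partial>(\<Pi>\<^sub>M i\<in>{..<n}. M))"
    unfolding dens using pos
    by (subst integral_density) (auto intro!: prod_nonneg AE_I2)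
  also have "\<dots> = (\<integral>y. tie_error (K n) (exp (- (\<Sum>i<n. V (y i)))) / ?c ^ n \<partial>(\<Pi>\<^sub>M i\<in>{..<n}. M))"
  proof (intro Bochner_Integration.integral_cong refl)
    fix y :: "nat \<Rightarrow> 'a"
    have "(\<Prod>i<n. exp (- V (y i)) / ?c) = exp (- (\<Sum>i<n. V (y i))) / ?c ^ n"
      by (simp add: prod_dividef exp_sum flip: sum_negf)
    then show "(\<Prod>i<n. exp (- V (y i)) / ?c) * ?F y = tie_error (K n) (exp (- (\<Sum>i<n. V (y i)))) / ?c ^ n"
      by (simp add: exp_minus)
  qed
  also have "\<dots> = expected_tie_error K n / ?c ^ n"
    by (simp add: expected_tie_error_def)
  finally show ?thesis
    using pos by simp
qed

text \<open>Second moments under the tilt are finite because V^2 \<open>exp (- V)\<close> is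
  bounded. The tilted measure has the same null sets as M, so a nonconstant V has positive tilted
  variance.\<close>

lemma weak_conv_tilted_sum:
  assumes R_eq: "R = tilted_mean" and nonconst: "\<not> (AE x in M. V x = R)"
  obtains \<sigma> where "0 < \<sigma>"
    "weak_conv_m (\<lambda>n. distr (\<Pi>\<^sub>M i\<in>(UNIV :: nat set). tilted_measure) borel
       (\<lambda>\<omega>. (\<Sum>i<n. V (\<omega> i) - R) / sqrt (real n * \<sigma>\<^sup>2))) std_normal_distribution"
proof -
  interpret T: prob_space tilted_measure
    by (rule prob_space_tilted_measure)
  interpret U: product_prob_space "\<lambda>_::nat. tilted_measure" UNIV
    by (rule product_prob_spaceI) (rule prob_space_tilted_measure)
  have int_V: "integrable tilted_measure V" and int_V2: "integrable tilted_measure (\<lambda>x. (V x)\<^sup>2)"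
    by (auto intro!: integrable_tilted_measure integrable_mult_exp integrable_square_exp)
  have mean: "T.expectation V = R"
    by (simp add: integral_tilted_measure R_eq tilted_mean_def)
  have int_var: "integrable tilted_measure (\<lambda>x. (V x - R)\<^sup>2)"
    unfolding power2_diff using int_V int_V2 by auto
  have "T.variance V \<noteq> 0"
  proof
    assume "T.variance V = 0"
    then have "AE x in tilted_measure. (V x - R)\<^sup>2 = 0"
      using integral_nonneg_eq_0_iff_AE[OF int_var] by (simp add: mean)
    with nonconst show False
      by (simp add: AE_tilted_measure)
  qed
  with T.variance_positive[of V] have var: "0 < T.variance V"
    by linarith
  define \<sigma> where "\<sigma> = sqrt (T.variance V)"
  have distr_coord: "distr (\<Pi>\<^sub>M i\<in>UNIV. tilted_measure) tilted_measure (\<lambda>\<omega>. \<omega> i) = tilted_measure" for i :: nat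
    using U.PiM_component[of i] by simp
  have exp_coord: "U.expectation (\<lambda>\<omega>. f (V (\<omega> i))) = T.expectation (\<lambda>x. f (V x))"
    if [measurable]: "f \<in> borel_measurable borel" for f :: "real \<Rightarrow> real" and i :: nat
    by (subst distr_coord[of i, symmetric], subst integral_distr) auto
  have coord [measurable]: "(\<lambda>\<omega>. V (\<omega> i)) \<in> borel_measurable (\<Pi>\<^sub>M i\<in>UNIV. tilted_measure)" for i :: nat
    by measurable
  have "weak_conv_m (\<lambda>n. distr (\<Pi>\<^sub>M i\<in>UNIV. tilted_measure) borel
       (\<lambda>\<omega>. (\<Sum>i<n. V (\<omega> i) - R) / sqrt (real n * \<sigma>\<^sup>2))) std_normal_distribution"
  proof (rule U.central_limit_theorem)
    show "U.indep_vars (\<lambda>i. borel) (\<lambda>i \<omega>. V (\<omega> i)) UNIV"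
      by (rule U.indep_vars_compose2[OF T.indep_vars_PiM_coordinates]) auto
    show "U.expectation (\<lambda>\<omega>. V (\<omega> i)) = R" for i :: nat
      using exp_coord[of "\<lambda>x. x" i] mean by simp
    show "0 < \<sigma>"
      using var by (simp add: \<sigma>_def)
    show "integrable (\<Pi>\<^sub>M i\<in>UNIV. tilted_measure) (\<lambda>\<omega>. (V (\<omega> i))\<^sup>2)" for i :: nat
      using int_V2 by (subst (asm) distr_coord[of i, symmetric]) (simp add: integrable_distr_eq)
    show "U.variance (\<lambda>\<omega>. V (\<omega> i)) = \<sigma>\<^sup>2" for i :: nat
      using exp_coord[of "\<lambda>x. x" i] exp_coord[of "\<lambda>x. (x - R)\<^sup>2" i] mean var by (simp add: \<sigma>_def)
    show "distr (\<Pi>\<^sub>M i\<in>UNIV. tilted_measure) borel (\<lambda>\<omega>. V (\<omega> i)) = distr tilted_measure borel V" for i :: nat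
      by (subst (2) distr_coord[of i, symmetric], subst distr_distr) (auto simp: comp_def)
  qed
  with var show ?thesis
    by (intro that[of \<sigma>]) (auto simp: \<sigma>_def)
qed

text \<open>With S = n R + t c and c of order sqrt n, the product q \<open>exp (n * R)\<close>
  equals \<open>exp (- t * c)\<close>. So the normalised integrand u is close to 1/2 for t > e and
  close to 0 for t < -e. On the window between it is bounded, and the limiting probability of the
  window vanishes with e because the normal law has no atom at 0.\<close>

lemma expected_tie_error_at_tilted_mean:
  assumes R_eq: "R = tilted_mean" and nonconst: "\<not> (AE x in M. V x = R)"
  shows "(\<lambda>n. expected_tie_error K n / (exp (real n * R) * laplace 1 ^ n)) \<longlonglongrightarrow> 1 / 4"
proof -
  interpret T: prob_space tilted_measure
    by (rule prob_space_tilted_measure)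
  interpret U: product_prob_space "\<lambda>_::nat. tilted_measure" UNIV
    by (rule product_prob_spaceI) (rule prob_space_tilted_measure)
  let ?U = "\<Pi>\<^sub>M i\<in>(UNIV :: nat set). tilted_measure"
  let ?\<Phi> = "cdf std_normal_distribution"
  obtain \<sigma> where \<sigma>: "0 < \<sigma>" and
    conv: "weak_conv_m (\<lambda>n. distr ?U borel
       (\<lambda>\<omega>. (\<Sum>i<n. V (\<omega> i) - R) / sqrt (real n * \<sigma>\<^sup>2))) std_normal_distribution"
    using weak_conv_tilted_sum[OF assms] .
  define t where "t n \<omega> = (\<Sum>i<n. V (\<omega> i) - R) / sqrt (real n * \<sigma>\<^sup>2)" for n \<omega>
  define c where "c n = sqrt (real n) * \<sigma>" for n
  have [measurable]: "t n \<in> borel_measurable ?U" for n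
    unfolding t_def by measurable
  have cdf_lim: "(\<lambda>n. U.prob {\<omega> \<in> space ?U. t n \<omega> \<le> x}) \<longlonglongrightarrow> ?\<Phi> x" for x
    using conv isCont_cdf_std_normal[of x]
    by (simp add: weak_conv_m_def weak_conv_def cdf_def measure_distr t_def[symmetric] vimage_def Int_def conj_commute)
  define S where "S n \<omega> = (\<Sum>i<n. V (\<omega> i))" for n and \<omega> :: "nat \<Rightarrow> 'a"
  have [measurable]: "S n \<in> borel_measurable ?U" for n
    unfolding S_def by measurable
  \<comment> \<open>At n = 0 the sums are empty and c is 0, so the division by zero inside t does no
    harm.\<close>
  have S_eq: "S n \<omega> = real n * R + t n \<omega> * c n" for n \<omega>
    using \<sigma> by (cases "n = 0") (simp_all add: S_def t_def c_def sum_subtractf real_sqrt_mult)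
  define u where "u n \<omega> = tie_error (K n) (exp (- S n \<omega>)) * exp (S n \<omega>) / exp (real n * R)" for n \<omega>
  have [measurable]: "u n \<in> borel_measurable ?U" for n
    unfolding u_def by measurable
  have ratio: "expected_tie_error K n / (exp (real n * R) * laplace 1 ^ n) = U.expectation (u n)" for n
    using laplace_pos[of 1] unfolding expected_tie_error_tilted u_def S_def by simp
  have S_nonneg: "0 \<le> S n \<omega>" if "\<omega> \<in> space ?U" for n \<omega>
    using that V_nonneg by (auto simp: S_def space_PiM PiE_iff tilted_measure_def intro!: sum_nonneg)
  \<comment> \<open>In order: positivity of the tie error, its linear bound with K - 1, its bound by
    1, and its quadratic lower bound, where 4 is the square of the 2 in K \<le> 2
    \<open>exp (n * R)\<close>.\<close>
  have u_bounds: "0 \<le> u n \<omega>" "u n \<omega> \<le> 1 / 2" "u n \<omega> \<le> exp (t n \<omega> * c n)"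
      "1 / 2 - exp (- (real n * R)) / 2 - 4 * exp (- (t n \<omega> * c n)) \<le> u n \<omega>"
    if \<omega>: "\<omega> \<in> space ?U" for n \<omega>
  proof -
    let ?E = "exp (real n * R)"
    define q where "q = exp (- S n \<omega>)"
    have q: "0 < q" "q \<le> 1"
      using S_nonneg[OF \<omega>] by (auto simp: q_def)
    have u_eq: "u n \<omega> = tie_error (K n) q / (q * ?E)"
      by (simp add: u_def q_def exp_minus field_simps)
    note bounds = tie_error_nonneg[OF q K_pos[of n]] tie_error_le_1[OF q K_pos[of n]]
      tie_error_le[OF q K_pos[of n]] tie_error_ge_quadratic[OF q K_pos[of n]]
    show "0 \<le> u n \<omega>"
      unfolding u_eq using q bounds by simp
    have "(real (K n) - 1) * q / 2 \<le> ?E * q / 2"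
      using K_le[of n] q by (intro divide_right_mono mult_right_mono) auto
    with bounds(3) q show "u n \<omega> \<le> 1 / 2"
      unfolding u_eq by (simp add: field_simps)
    have qE: "q * ?E = exp (- (t n \<omega> * c n))"
      by (simp add: q_def S_eq flip: exp_add)
    have "u n \<omega> \<le> 1 / (q * ?E)"
      unfolding u_eq using q bounds(2) by (intro divide_right_mono) auto
    then show "u n \<omega> \<le> exp (t n \<omega> * c n)"
      unfolding qE by (simp add: exp_minus field_simps)
    have "(real (K n) * q)\<^sup>2 \<le> (2 * ?E * q)\<^sup>2"
      using K_le_double q by (intro power_mono mult_right_mono) auto
    moreover have "(?E - 1) * q / 2 \<le> (real (K n) - 1) * q / 2"
      using K_ge[of n] q by (intro divide_right_mono mult_right_mono) auto
    ultimately have "(?E - 1) * q / 2 - (2 * ?E * q)\<^sup>2 \<le> tie_error (K n) q"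
      using bounds(4) by linarith
    then have "((?E - 1) * q / 2 - (2 * ?E * q)\<^sup>2) / (q * ?E) \<le> u n \<omega>"
      unfolding u_eq using q by (intro divide_right_mono) auto
    also have "((?E - 1) * q / 2 - (2 * ?E * q)\<^sup>2) / (q * ?E) = 1 / 2 - exp (- (real n * R)) / 2 - 4 * (q * ?E)"
      using q by (simp add: field_simps power2_eq_square exp_minus)
    finally show "1 / 2 - exp (- (real n * R)) / 2 - 4 * exp (- (t n \<omega> * c n)) \<le> u n \<omega>"
      unfolding qE .
  qed
  have u_int: "integrable ?U (u n)" for n
    using u_bounds by (intro U.integrable_const_bound[where B="1 / 2"] AE_I2) auto
  let ?G = "\<lambda>n x. U.prob {\<omega> \<in> space ?U. t n \<omega> \<le> x}"
  have total: "U.prob (space ?U) = 1"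
    by (rule U.P.prob_space)
  have tail: "U.prob {\<omega> \<in> space ?U. x < t n \<omega>} = 1 - ?G n x" for n x
  proof -
    have "{\<omega> \<in> space ?U. x < t n \<omega>} = space ?U - {\<omega> \<in> space ?U. t n \<omega> \<le> x}"
      by auto
    then show ?thesis
      by (simp add: U.prob_compl)
  qed
  have tail_int: "integrable ?U (indicat_real {\<omega> \<in> space ?U. x < t n \<omega>})" for n x
    by (intro integrable_real_indicator) (auto simp: U.emeasure_eq_measure)
  \<comment> \<open>The bound 1/2 is spent on t > -e, including the undecided window, and the
    exponential bound on the rest; \<open>lower\<close> below cuts at e instead.\<close>
  have upper: "U.expectation (u n) \<le> (1 - ?G n (- e)) / 2 + exp (- (e * c n))" if e: "0 < e" for n e
  proof -
    have "U.expectation (u n) \<le> U.expectation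
        (\<lambda>\<omega>. indicator {\<omega> \<in> space ?U. - e < t n \<omega>} \<omega> / 2 + exp (- (e * c n)))"
    proof (intro integral_mono u_int)
      fix \<omega> assume \<omega>: "\<omega> \<in> space ?U"
      have c0: "0 \<le> c n"
        using \<sigma> by (simp add: c_def)
      show "u n \<omega> \<le> indicator {\<omega> \<in> space ?U. - e < t n \<omega>} \<omega> / 2 + exp (- (e * c n))"
      proof (cases "- e < t n \<omega>")
        case True
        with u_bounds(2)[OF \<omega>, of n] \<omega> show ?thesis
          by (simp add: add_increasing2)
      next
        case False
        then have "t n \<omega> * c n \<le> - e * c n"
          using c0 by (intro mult_right_mono) auto
        then have "exp (t n \<omega> * c n) \<le> exp (- (e * c n))"
          by simp
        with u_bounds(3)[OF \<omega>, of n] have "u n \<omega> \<le> exp (- (e * c n))"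
          by (rule order_trans)
        with False show ?thesis
          by simp
      qed
    qed (intro Bochner_Integration.integrable_add integrable_divide tail_int U.integrable_const)
    also have "\<dots> = (1 - ?G n (- e)) / 2 + exp (- (e * c n))"
      by (subst Bochner_Integration.integral_add) (auto simp: tail tail_int total)
    finally show ?thesis .
  qed
  have lower: "(1 - ?G n e) / 2 - (exp (- (real n * R)) / 2 + 4 * exp (- (e * c n))) \<le> U.expectation (u n)"
    if e: "0 < e" for n e
  proof -
    let ?d = "exp (- (real n * R)) / 2 + 4 * exp (- (e * c n))"
    have "(1 - ?G n e) / 2 - ?d = U.expectation (\<lambda>\<omega>. indicator {\<omega> \<in> space ?U. e < t n \<omega>} \<omega> / 2 - ?d)"
      by (subst Bochner_Integration.integral_diff) (auto simp: tail tail_int total)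
    also have "\<dots> \<le> U.expectation (u n)"
    proof (intro integral_mono u_int)
      fix \<omega> assume \<omega>: "\<omega> \<in> space ?U"
      have c0: "0 \<le> c n"
        using \<sigma> by (simp add: c_def)
      show "indicator {\<omega> \<in> space ?U. e < t n \<omega>} \<omega> / 2 - ?d \<le> u n \<omega>"
      proof (cases "e < t n \<omega>")
        case False
        have "0 \<le> ?d" by (intro add_nonneg_nonneg) auto
        with u_bounds(1)[OF \<omega>, of n] have "- ?d \<le> u n \<omega>"
          by linarith
        with False show ?thesis
          by simp
      next
        case True
        then have "e * c n \<le> t n \<omega> * c n"
          using c0 by (intro mult_right_mono) auto
        then have "exp (- (t n \<omega> * c n)) \<le> exp (- (e * c n))"
          by simp
        with u_bounds(4)[OF \<omega>, of n] have "1 / 2 - ?d \<le> u n \<omega>"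
          by linarith
        with True \<omega> show ?thesis
          by simp
      qed
    qed (intro Bochner_Integration.integrable_diff integrable_divide tail_int U.integrable_const)
    finally show ?thesis .
  qed
  have c_lim: "(\<lambda>n. exp (- (e * c n))) \<longlonglongrightarrow> 0" if "0 < e" for e
    using that \<sigma> unfolding c_def by real_asymp
  have R_lim: "(\<lambda>n. exp (- (real n * R))) \<longlonglongrightarrow> 0"
    using R by real_asymp
  have upper_lim: "(\<lambda>n. (1 - ?G n (- e)) / 2 + exp (- (e * c n))) \<longlonglongrightarrow> (1 - ?\<Phi> (- e)) / 2" if "0 < e" for e
    using tendsto_add[OF tendsto_divide[OF tendsto_diff[OF tendsto_const[of 1] cdf_lim[of "- e"]] tendsto_const[of 2]] c_lim[OF that]]
    by simp
  have lower_lim: "(\<lambda>n. (1 - ?G n e) / 2 - (exp (- (real n * R)) / 2 + 4 * exp (- (e * c n)))) \<longlonglongrightarrow> (1 - ?\<Phi> e) / 2"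
    if "0 < e" for e
    using tendsto_diff[OF tendsto_divide[OF tendsto_diff[OF tendsto_const[of 1] cdf_lim[of e]] tendsto_const[of 2]]
        tendsto_add[OF tendsto_divide[OF R_lim tendsto_const[of 2]] tendsto_mult[OF tendsto_const[of 4] c_lim[OF that]]]]
    by simp
  have at_0: "(?\<Phi> \<longlongrightarrow> 1 / 2) (at 0)"
    using isCont_cdf_std_normal[of 0] by (simp add: isCont_def cdf_std_normal_0)
  have pos_0: "((\<lambda>e. (1 - ?\<Phi> e) / 2) \<longlongrightarrow> 1 / 4) (at_right 0)"
    using tendsto_divide[OF tendsto_diff[OF tendsto_const[of 1] tendsto_within_subset[OF at_0, of "{0<..}"]] tendsto_const[of 2]]
    by simp
  have neg_0: "((\<lambda>e. (1 - ?\<Phi> (- e)) / 2) \<longlongrightarrow> 1 / 4) (at_right 0)"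
  proof -
    have "((\<lambda>e. ?\<Phi> (- e)) \<longlongrightarrow> 1 / 2) (at_right 0)"
      using tendsto_within_subset[OF at_0, of "{..<0}"] by (simp add: filterlim_at_left_to_right)
    from tendsto_divide[OF tendsto_diff[OF tendsto_const[of 1] this] tendsto_const[of 2]]
    show ?thesis by simp
  qed
  show ?thesis
    unfolding ratio
  proof (rule order_tendstoI)
    \<comment> \<open>The width e is fixed first, by continuity of the normal distribution function
      at 0; only then does n tend to infinity.\<close>
    fix a :: real assume "a < 1 / 4"
    from eventually_conj[OF order_tendstoD(1)[OF pos_0 this] eventually_at_right_less]
    have "eventually (\<lambda>e. a < (1 - ?\<Phi> e) / 2 \<and> 0 < e) (at_right 0)" .
    then obtain e where e: "a < (1 - ?\<Phi> e) / 2" "0 < e"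
      using eventually_happens by fastforce
    from order_tendstoD(1)[OF lower_lim[OF e(2)] e(1)]
    show "eventually (\<lambda>n. a < U.expectation (u n)) sequentially"
      by (rule eventually_mono) (erule less_le_trans[OF _ lower[OF e(2)]])
  next
    fix a :: real assume "1 / 4 < a"
    from eventually_conj[OF order_tendstoD(2)[OF neg_0 this] eventually_at_right_less]
    have "eventually (\<lambda>e. (1 - ?\<Phi> (- e)) / 2 < a \<and> 0 < e) (at_right 0)" .
    then obtain e where e: "(1 - ?\<Phi> (- e)) / 2 < a" "0 < e"
      using eventually_happens by fastforce
    from order_tendstoD(2)[OF upper_lim[OF e(2)] e(1)]
    show "eventually (\<lambda>n. U.expectation (u n) < a) sequentially"
      by (rule eventually_mono) (erule le_less_trans[OF upper[OF e(2)]])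
  qed
qed

end
end


section \<open>Singular channels\<close>

text \<open>The factors need only be sigma-finite, as Q is: a box with a null side is null even if
  its other sides have infinite measure, because \<open>0 * \<infinity> = 0\<close> in
  \<open>ennreal\<close>.\<close>

lemma (in product_sigma_finite) AE_PiM_finite_component:
  assumes I: "finite I" "i \<in> I" and A: "AE x in M i. A x"
  shows "AE x in PiM I M. A (x i)"
proof -
  from A obtain N where N: "N \<in> null_sets (M i)" "{x \<in> space (M i). \<not> A x} \<subseteq> N"
    by (auto simp: eventually_ae_filter)
  let ?N = "\<Pi>\<^sub>E j\<in>I. if j = i then N else space (M j)"
  have "emeasure (PiM I M) ?N = (\<Prod>j\<in>I. emeasure (M j) (if j = i then N else space (M j)))"
    using I N by (intro emeasure_PiM) auto
  also have "\<dots> = 0"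
    using I N by (intro prod_zero) (auto intro!: bexI[of _ i])
  finally have "?N \<in> null_sets (PiM I M)"
    using I N by (auto intro!: null_setsI sets_PiM_I_finite)
  moreover have "{x \<in> space (PiM I M). \<not> A (x i)} \<subseteq> ?N"
    using N I by (auto simp: space_PiM PiE_iff extensional_def)
  ultimately show ?thesis
    by (rule AE_I')
qed

locale singular_channel =
  fixes P :: "'x measure" and Q :: "'y measure" and w :: "'x \<Rightarrow> 'y \<Rightarrow> real"
  assumes channel: "channel_with_input P Q w" and sing: "singular P Q w"
begin

sublocale P: prob_space P
  using channel by (simp add: channel_with_input_def)

sublocale Q: sigma_finite_measure Q
  using channel by (simp add: channel_with_input_def)

sublocale PQ: pair_sigma_finite P Q ..

lemma w_measurable [measurable]: "case_prod w \<in> borel_measurable (P \<Otimes>\<^sub>M Q)"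
  using channel by (simp add: channel_with_input_def)

lemma w_nonneg: "x \<in> space P \<Longrightarrow> y \<in> space Q \<Longrightarrow> 0 \<le> w x y"
  using channel by (simp add: channel_with_input_def)

lemma w_measurable_output [measurable]: "x \<in> space P \<Longrightarrow> w x \<in> borel_measurable Q"
  using measurable_compose[OF measurable_Pair1' w_measurable] by simp

lemma w_measurable_input [measurable]: "y \<in> space Q \<Longrightarrow> (\<lambda>x. w x y) \<in> borel_measurable P"
  using measurable_compose[OF measurable_Pair2' w_measurable] by simp

lemma w_measurable_compose:
  assumes "f \<in> measurable N P" "g \<in> measurable N Q"
  shows "(\<lambda>z. w (f z) (g z)) \<in> borel_measurable N"
  using measurable_compose[OF measurable_Pair[OF assms] w_measurable] by simp

lemma prob_space_output_dist: "x \<in> space P \<Longrightarrow> prob_space (output_dist Q w x)"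
  using channel by (simp add: channel_with_input_def)

lemma nn_integral_w:
  assumes "x \<in> space P"
  shows "(\<integral>\<^sup>+y. ennreal (w x y) \<partial>Q) = 1"
proof -
  interpret W: prob_space "output_dist Q w x"
    using assms by (rule prob_space_output_dist)
  show ?thesis
    using W.emeasure_space_1 assms by (simp add: output_dist_def emeasure_density cong: nn_integral_cong)
qed

section \<open>Compatibility of inputs with an output\<close>

definition support_prob :: "'y \<Rightarrow> real" where
  "support_prob y = (\<integral>x. (if w x y = 0 then 0 else 1) \<partial>P)"

definition output_density :: "'y \<Rightarrow> real" where
  "output_density y = (\<integral>x. w x y \<partial>P)"

text \<open>Singularity makes the positive values of \<open>w x y\<close> independent of \<open>x\<close>; this is their
  common value.\<close>

definition common_density :: "'y \<Rightarrow> real" where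
  "common_density y = output_density y / support_prob y"

definition output_measure :: "'y measure" where
  "output_measure = density Q (\<lambda>y. ennreal (output_density y))"

text \<open>Since \<open>ln 0 = 0\<close>, the value is 0 where no input is compatible. This keeps
  \<open>info\<close> nonnegative everywhere, and such outputs have \<open>output_density\<close>
  0.\<close>

definition info :: "'y \<Rightarrow> real" where
  "info y = - ln (support_prob y)"

lemma support_prob_measurable [measurable]: "support_prob \<in> borel_measurable Q"
  unfolding support_prob_def [abs_def] by measurable

lemma output_density_measurable [measurable]: "output_density \<in> borel_measurable Q"
  unfolding output_density_def [abs_def] by measurable

lemma common_density_measurable [measurable]: "common_density \<in> borel_measurable Q"
  unfolding common_density_def [abs_def] by measurable

lemma info_measurable [measurable]: "info \<in> borel_measurable Q"
  unfolding info_def [abs_def] by measurable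

lemma integrable_support: "y \<in> space Q \<Longrightarrow> integrable P (\<lambda>x. if w x y = 0 then 0 else 1 :: real)"
  by (intro P.integrable_const_bound[where B=1]) auto

lemma support_prob_nonneg: "0 \<le> support_prob y"
  unfolding support_prob_def by (intro integral_nonneg_AE) auto

lemma support_prob_le_1:
  assumes "y \<in> space Q"
  shows "support_prob y \<le> 1"
proof -
  have "support_prob y \<le> (\<integral>x. 1 \<partial>P)"
    unfolding support_prob_def using integrable_support[OF assms]
    by (intro integral_mono) auto
  then show ?thesis
    by (simp add: P.prob_space)
qed

lemma support_prob_eq_prob:
  assumes y: "y \<in> space Q"
  shows "support_prob y = P.prob {x \<in> space P. w x y \<noteq> 0}"
proof -
  have "support_prob y = (\<integral>x. indicator {x \<in> space P. w x y \<noteq> 0} x \<partial>P)"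
    unfolding support_prob_def by (intro Bochner_Integration.integral_cong) (auto simp: indicator_def)
  with y show ?thesis
    by simp
qed

lemma AE_zero_if_support_prob_zero:
  assumes y: "y \<in> space Q" and q0: "support_prob y = 0"
  shows "AE x in P. w x y = 0"
  using q0 y P.prob_eq_0[of "{x \<in> space P. w x y \<noteq> 0}"] by (auto simp: support_prob_eq_prob)

lemma output_density_zero:
  assumes "y \<in> space Q" "support_prob y = 0"
  shows "output_density y = 0"
  unfolding output_density_def
  using AE_zero_if_support_prob_zero[OF assms] by (rule integral_eq_zero_AE)

lemma output_density_nonneg: "y \<in> space Q \<Longrightarrow> 0 \<le> output_density y"
  unfolding output_density_def using w_nonneg by (intro integral_nonneg_AE) auto

lemma common_density_nonneg: "y \<in> space Q \<Longrightarrow> 0 \<le> common_density y"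
  unfolding common_density_def by (intro divide_nonneg_nonneg output_density_nonneg support_prob_nonneg)

lemma common_times_support: "y \<in> space Q \<Longrightarrow> common_density y * support_prob y = output_density y"
  using output_density_zero by (auto simp: common_density_def)

lemma info_nonneg: "y \<in> space Q \<Longrightarrow> 0 \<le> info y"
  unfolding info_def using support_prob_le_1 support_prob_nonneg[of y]
  by (cases "support_prob y = 0") (auto simp: ln_le_zero_iff)

lemma exp_minus_info:
  assumes "support_prob y \<noteq> 0"
  shows "exp (- info y) = support_prob y"
  using assms support_prob_nonneg[of y] by (simp add: info_def)

lemma nu_zero_iff:
  assumes "x \<in> space P" "x' \<in> space P" "y \<in> space Q" "0 < w x y"
  shows "nu w x y x' \<in> {-\<infinity>, 0} \<longleftrightarrow> w x' y \<in> {0, w x y}"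
proof (cases "w x' y = 0")
  case False
  with w_nonneg[of x' y] assms have "0 < w x' y"
    by simp
  then have "ln (w x' y / w x y) = 0 \<longleftrightarrow> w x' y = w x y"
    using assms by (subst ln_eq_zero_iff) auto
  with False show ?thesis
    by (auto simp: nu_def zero_ereal_def)
qed (simp add: nu_def)

text \<open>Singularity concerns pairs (x, y) with positive density. After exchanging the order, for
  almost every y a single compatible x already determines the likelihood of almost all other
  compatible inputs.\<close>

lemma AE_common_density: "AE y in Q. AE x in P. w x y \<in> {0, common_density y}"
proof -
  interpret QP: pair_sigma_finite Q P ..
  let ?S = "\<lambda>z. AE x' in P. nu w (fst z) (snd z) x' \<in> {-\<infinity>, 0}"
  have "AE z in joint P Q w. ?S z"
    using sing by (simp add: singular_def case_prod_beta)
  then have "AE z in P \<Otimes>\<^sub>M Q. 0 < ennreal (w (fst z) (snd z)) \<longrightarrow> ?S z"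
    unfolding joint_def by (subst (asm) AE_density) (auto simp: case_prod_beta)
  then have "AE z in Q \<Otimes>\<^sub>M P. 0 < ennreal (w (snd z) (fst z)) \<longrightarrow> ?S (snd z, fst z)"
    by (subst (asm) PQ.distr_pair_swap, drule_tac AE_distrD[rotated]) (auto simp: case_prod_beta)
  from QP.AE_pair[OF this]
  have "AE y in Q. AE x in P. 0 < ennreal (w x y) \<longrightarrow> ?S (x, y)"
    by simp
  then show ?thesis
    using AE_space
  proof eventually_elim
    case (elim y)
    then have y: "y \<in> space Q" and S: "AE x in P. 0 < w x y \<longrightarrow> ?S (x, y)"
      by auto
    have "\<exists>v. AE x in P. w x y \<in> {0, v}"
    proof (cases "\<exists>x\<in>space P. 0 < w x y \<and> ?S (x, y)")
      case True
      then obtain x where x: "x \<in> space P" "0 < w x y" "?S (x, y)"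
        by auto
      from x(3) AE_space have "AE x' in P. w x' y \<in> {0, w x y}"
        by eventually_elim (use nu_zero_iff[OF x(1) _ y x(2)] in auto)
      then show ?thesis
        by auto
    next
      \<comment> \<open>Without a witness almost every input has likelihood 0, and any v would
        do.\<close>
      case False
      from S AE_space have "AE x in P. w x y \<in> {0, 0}"
        by eventually_elim (use False w_nonneg[OF _ y] in force)
      then show ?thesis
        by blast
    qed
    then obtain v where v: "AE x in P. w x y \<in> {0, v}" ..
    \<comment> \<open>The witness x depends on y in an uncontrolled way; integrating recovers v as a
      ratio of two integrals that are measurable in y.\<close>
    have "output_density y = (\<integral>x. v * (if w x y = 0 then 0 else 1) \<partial>P)"
      unfolding output_density_def using y v by (intro integral_cong_AE) auto
    also have "\<dots> = v * support_prob y"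
      by (simp add: support_prob_def)
    finally have p: "output_density y = v * support_prob y" .
    show ?case
    proof (cases "support_prob y = 0")
      case True
      from AE_zero_if_support_prob_zero[OF y this] show ?thesis
        by eventually_elim simp
    next
      case False
      with p v show ?thesis
        by (simp add: common_density_def)
    qed
  qed
qed

text \<open>For almost every y, x \<mapsto> w x y takes at most two values almost everywhere, hence
  is integrable, so the Bochner integral \<open>output_density\<close> is no default value.\<close>

lemma AE_nn_integral_w: "AE y in Q. (\<integral>\<^sup>+x. ennreal (w x y) \<partial>P) = ennreal (output_density y)"
  using AE_common_density AE_space
proof eventually_elim
  case (elim y)
  have "integrable P (\<lambda>x. w x y)"
    using elim by (intro P.integrable_const_bound[where B="\<bar>common_density y\<bar>"]) auto
  then show ?case
    unfolding output_density_def using elim w_nonneg by (intro nn_integral_eq_integral) auto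
qed

lemma sets_joint [measurable_cong]: "sets (joint P Q w) = sets (P \<Otimes>\<^sub>M Q)"
  by (simp add: joint_def)

lemma sets_output_measure [measurable_cong]: "sets output_measure = sets Q"
  by (simp add: output_measure_def)

lemma space_output_measure: "space output_measure = space Q"
  by (simp add: output_measure_def)

lemma distr_joint_snd: "distr (joint P Q w) Q snd = output_measure"
proof (rule measure_eqI)
  fix A assume "A \<in> sets (distr (joint P Q w) Q snd)"
  then have A [measurable]: "A \<in> sets Q" by simp
  have "emeasure (distr (joint P Q w) Q snd) A = (\<integral>\<^sup>+y. indicator A y \<partial>distr (joint P Q w) Q snd)"
    by (subst nn_integral_indicator) auto
  also have "\<dots> = (\<integral>\<^sup>+z. ennreal (case_prod w z) * indicator A (snd z) \<partial>(P \<Otimes>\<^sub>M Q))"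
    by (subst nn_integral_distr, simp, simp, unfold joint_def, subst nn_integral_density)
       (auto simp: case_prod_beta)
  also have "\<dots> = (\<integral>\<^sup>+y. \<integral>\<^sup>+x. ennreal (w x y) * indicator A y \<partial>P \<partial>Q)"
    by (subst PQ.nn_integral_snd[symmetric]) (auto simp: case_prod_beta)
  also have "\<dots> = (\<integral>\<^sup>+y. ennreal (output_density y) * indicator A y \<partial>Q)"
    using AE_nn_integral_w AE_space
    by (intro nn_integral_cong_AE, eventually_elim) (simp add: nn_integral_multc)
  finally show "emeasure (distr (joint P Q w) Q snd) A = emeasure output_measure A"
    by (simp add: emeasure_density output_measure_def)
qed (simp add: sets_output_measure)

lemma prob_space_output_measure: "prob_space output_measure"
proof
  have "emeasure output_measure (space output_measure) = (\<integral>\<^sup>+y. ennreal (output_density y) \<partial>Q)"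
    unfolding output_measure_def by (subst emeasure_density) (auto intro!: nn_integral_cong)
  also have "\<dots> = (\<integral>\<^sup>+y. (\<integral>\<^sup>+x. ennreal (w x y) \<partial>P) \<partial>Q)"
    using AE_nn_integral_w by (intro nn_integral_cong_AE) auto
  also have "\<dots> = (\<integral>\<^sup>+x. (\<integral>\<^sup>+y. ennreal (w x y) \<partial>Q) \<partial>P)"
    by (rule PQ.Fubini') simp
  also have "\<dots> = 1"
    by (simp add: nn_integral_w P.emeasure_space_1 cong: nn_integral_cong)
  finally show "emeasure output_measure (space output_measure) = 1" .
qed

sublocale O: nonneg_random_variable output_measure info
proof -
  interpret prob_space output_measure
    by (rule prob_space_output_measure)
  show "nonneg_random_variable output_measure info"
    by unfold_locales (auto simp: info_nonneg space_output_measure)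
qed

lemma mgf_measurable [measurable]:
  "(\<lambda>z. mgf P w z (l::real)) \<in> borel_measurable (P \<Otimes>\<^sub>M Q)"
proof -
  have [measurable]: "(\<lambda>(z, x'). w x' (snd z)) \<in> borel_measurable ((P \<Otimes>\<^sub>M Q) \<Otimes>\<^sub>M P)"
    "(\<lambda>(z, x'). w (fst z) (snd z)) \<in> borel_measurable ((P \<Otimes>\<^sub>M Q) \<Otimes>\<^sub>M P)"
    unfolding case_prod_beta by (intro w_measurable_compose; measurable)+
  have "(\<lambda>z. mgf P w z l) = (\<lambda>z. \<integral>x'. (if w x' (snd z) = 0 then 0
      else exp (l * ln (w x' (snd z) / w (fst z) (snd z)))) \<partial>P)"
    by (auto simp: mgf_def exp_mult_def nu_def case_prod_beta fun_eq_iff intro!: Bochner_Integration.integral_cong)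
  also have "\<dots> \<in> borel_measurable (P \<Otimes>\<^sub>M Q)"
    by measurable
  finally show ?thesis .
qed

text \<open>With \<nu> in {-\<infinity>, 0}, the exponential of l \<nu> is the indicator of
  compatibility whatever l is. Hence Z does not depend on its argument, and the inner 1 / (1 + a) of
  \<Lambda> disappears.\<close>

lemma AE_mgf: "AE z in joint P Q w. mgf P w z (l::real) = support_prob (snd z)"
proof -
  have "AE z in joint P Q w. AE x' in P. nu w (fst z) (snd z) x' \<in> {-\<infinity>, 0}"
    using sing by (simp add: singular_def case_prod_beta)
  then show ?thesis
    using AE_space
  proof eventually_elim
    case (elim z)
    obtain x y where z: "z = (x, y)" by (cases z)
    with elim have xy: "x \<in> space P" "y \<in> space Q"
      by (auto simp: joint_def space_pair_measure)
    have [measurable]: "(\<lambda>x'. exp_mult l (nu w x y x')) \<in> borel_measurable P"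
    proof -
      have "(\<lambda>x'. exp_mult l (nu w x y x')) = (\<lambda>x'. if w x' y = 0 then 0 else exp (l * ln (w x' y / w x y)))"
        by (auto simp: exp_mult_def nu_def)
      also have "\<dots> \<in> borel_measurable P"
        using xy by measurable
      finally show ?thesis .
    qed
    have "AE x' in P. exp_mult l (nu w x y x') = (if w x' y = 0 then 0 else 1)"
      using elim(1) by eventually_elim (auto simp: z exp_mult_def nu_def zero_ereal_def)
    then show ?case
      unfolding z mgf_def support_prob_def using xy by (auto intro!: integral_cong_AE)
  qed
qed

lemma AE_Z: "AE z in joint P Q w. Z P w z l = - info (snd z)"
  using AE_mgf[of l] by eventually_elim (simp add: Z_def info_def)

lemma integral_joint_snd:
  fixes f :: "'y \<Rightarrow> real"
  assumes [measurable]: "f \<in> borel_measurable Q"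
  shows "(\<integral>z. f (snd z) \<partial>joint P Q w) = (\<integral>y. f y \<partial>output_measure)"
  unfolding distr_joint_snd[symmetric] by (subst integral_distr) auto

section \<open>Rate, exponent and critical rate in terms of the output law\<close>

lemma mutual_info_eq: "mutual_info P Q w = O.expectation info"
proof -
  have "mutual_info P Q w = (\<integral>z. info (snd z) \<partial>joint P Q w)"
    unfolding mutual_info_def using AE_mgf[of 1]
    by (intro integral_cong_AE) (auto simp: info_def)
  then show ?thesis
    by (simp add: integral_joint_snd)
qed

lemma finite_mutual_info_iff: "finite_mutual_info P Q w \<longleftrightarrow> integrable output_measure info"
proof -
  have "finite_mutual_info P Q w \<longleftrightarrow> integrable (joint P Q w) (\<lambda>z. info (snd z))"
    unfolding finite_mutual_info_def using AE_mgf[of 1]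
    by (intro integrable_cong_AE) (auto simp: info_def)
  then show ?thesis
    unfolding distr_joint_snd[symmetric] by (subst integrable_distr_eq) auto
qed

lemma Lambda_eq: "Lambda P Q w a = ln (O.laplace a)"
proof -
  have [measurable]: "(\<lambda>z. Z P w z l) \<in> borel_measurable (P \<Otimes>\<^sub>M Q)" for l
    unfolding Z_def by measurable
  have "(\<integral>z. exp (a * Z P w z (1 / (1 + a))) \<partial>joint P Q w) = (\<integral>z. exp (- (a * info (snd z))) \<partial>joint P Q w)"
    using AE_Z[of "1 / (1 + a)"] by (intro integral_cong_AE) auto
  then show ?thesis
    by (simp add: Lambda_def O.laplace_def integral_joint_snd[of "\<lambda>y. exp (- (a * info y))"])
qed

lemma rho_minimizer:
  assumes fin: "finite_mutual_info P Q w" and R: "R < mutual_info P Q w"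
  shows "rho P Q w R \<in> {0<..1}"
    and "\<And>a. a \<in> {0<..1} \<Longrightarrow> rho P Q w R * R + Lambda P Q w (rho P Q w R) \<le> a * R + Lambda P Q w a"
proof -
  obtain a where a: "0 < a" "a \<le> 1"
    "\<And>b. 0 < b \<Longrightarrow> b \<le> 1 \<Longrightarrow> a * R + ln (O.laplace a) \<le> b * R + ln (O.laplace b)"
    using O.exists_minimizer[of R] fin R by (auto simp: finite_mutual_info_iff mutual_info_eq)
  then have "is_arg_min (\<lambda>a. a * R + Lambda P Q w a) (\<lambda>a. a \<in> {0<..1}) a"
    by (auto simp: is_arg_min_linorder Lambda_eq)
  then have "is_arg_min (\<lambda>a. a * R + Lambda P Q w a) (\<lambda>a. a \<in> {0<..1}) (rho P Q w R)"
    unfolding rho_def arg_min_def by (rule someI)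
  then show "rho P Q w R \<in> {0<..1}"
    and "\<And>a. a \<in> {0<..1} \<Longrightarrow> rho P Q w R * R + Lambda P Q w (rho P Q w R) \<le> a * R + Lambda P Q w a"
    by (auto simp: is_arg_min_linorder)
qed

lemma rho_eq_1_iff:
  assumes fin: "finite_mutual_info P Q w" and R: "R < mutual_info P Q w"
  shows "rho P Q w R = 1 \<longleftrightarrow> R \<le> O.tilted_mean"
proof
  assume rho: "rho P Q w R = 1"
  show "R \<le> O.tilted_mean"
  proof (rule ccontr)
    assume "\<not> R \<le> O.tilted_mean"
    then obtain d where d: "0 < d" "d < 1" "O.laplace (1 - d) < O.laplace 1 * exp (d * R)"
      using O.laplace_less_above_tilted_mean[of R] by auto
    have "ln (O.laplace (1 - d)) < ln (O.laplace 1 * exp (d * R))"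
      using d O.laplace_pos[of "1 - d"] O.laplace_pos[of 1] by (subst ln_less_cancel_iff) auto
    also have "\<dots> = ln (O.laplace 1) + d * R"
      using O.laplace_pos[of 1] by (simp add: ln_mult)
    finally have "(1 - d) * R + ln (O.laplace (1 - d)) < R + ln (O.laplace 1)"
      by (simp add: algebra_simps)
    with rho_minimizer(2)[OF fin R, of "1 - d"] rho d show False
      by (simp add: Lambda_eq)
  qed
next
  assume le: "R \<le> O.tilted_mean"
  let ?r = "rho P Q w R"
  have r: "0 < ?r" "?r \<le> 1"
    using rho_minimizer(1)[OF fin R] by auto
  \<comment> \<open>At R equal to the tilted mean uniqueness needs a nonconstant
    \<open>info\<close>; a constant one would have mean R, contradicting R < I(X;Y).\<close>
  have "R < O.tilted_mean \<or> \<not> (AE y in output_measure. info y = O.tilted_mean)"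
  proof (rule disjCI)
    assume "\<not> \<not> (AE y in output_measure. info y = O.tilted_mean)"
    then have "O.expectation info = O.expectation (\<lambda>_. O.tilted_mean)"
      by (intro integral_cong_AE) auto
    with R show "R < O.tilted_mean"
      by (simp add: mutual_info_eq O.prob_space)
  qed
  with O.minimum_at_1(2)[OF r le] rho_minimizer(2)[OF fin R, of 1] show "?r = 1"
    by (force simp: Lambda_eq)
qed

text \<open>In the first branch every admissible rate has \<rho> = 1; by Chebyshev's association
  inequality this happens only for almost surely constant \<open>info\<close>, and then with
  equality.\<close>

lemma R_crit_cases:
  assumes fin: "finite_mutual_info P Q w" and pos: "0 < mutual_info P Q w"
  shows "R_crit P Q w = (if mutual_info P Q w \<le> O.tilted_mean then mutual_info P Q w else O.tilted_mean)"
proof (cases "mutual_info P Q w \<le> O.tilted_mean")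
  case True
  then show ?thesis
    using rho_eq_1_iff[OF fin] by (auto simp: R_crit_def)
next
  case False
  let ?I = "mutual_info P Q w"
  \<comment> \<open>Places the tilted mean inside the range of the \<open>GREATEST\<close>:
    otherwise \<open>info\<close> would vanish almost surely and I(X;Y) would be 0.\<close>
  have tm_pos: "0 < O.tilted_mean"
  proof (rule ccontr)
    assume "\<not> 0 < O.tilted_mean"
    then have "O.expectation (\<lambda>y. info y * exp (- info y)) \<le> 0"
      using O.laplace_pos[of 1] by (auto simp: O.tilted_mean_def zero_less_divide_iff)
    moreover have "0 \<le> O.expectation (\<lambda>y. info y * exp (- info y))"
      by (intro integral_nonneg_AE AE_I2) (auto simp: info_nonneg space_output_measure)
    ultimately have "O.expectation (\<lambda>y. info y * exp (- info y)) = 0"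
      by simp
    then have "AE y in output_measure. info y * exp (- info y) = 0"
      using O.integrable_mult_exp
      by (subst (asm) integral_nonneg_eq_0_iff_AE) (auto simp: info_nonneg space_output_measure)
    then have "O.expectation info = O.expectation (\<lambda>_. 0)"
      by (intro integral_cong_AE) auto
    with pos show False
      by (simp add: mutual_info_eq)
  qed
  obtain R' where R': "O.tilted_mean < R'" "R' < ?I"
    using False dense[of "O.tilted_mean" ?I] by auto
  have "rho P Q w R' \<noteq> 1" "R' \<in> {0<..<?I}"
    using R' rho_eq_1_iff[OF fin, of R'] tm_pos by auto
  then have "R_crit P Q w = (GREATEST R. R \<in> {0<..<?I} \<and> rho P Q w R = 1)"
    unfolding R_crit_def by auto
  also have "\<dots> = O.tilted_mean"
    using False tm_pos rho_eq_1_iff[OF fin] by (intro Greatest_equality) auto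
  finally show ?thesis
    using False by simp
qed

lemma E_r_eq:
  assumes "R \<le> O.tilted_mean"
  shows "E_r P Q w R = - (R + ln (O.laplace 1))"
proof -
  have "(INF a\<in>{0<..1}. a * R + Lambda P Q w a) = R + ln (O.laplace 1)"
    using O.minimum_at_1(1)[OF _ _ assms]
    by (intro cInf_eq_minimum) (auto simp: Lambda_eq intro!: image_eqI[of _ _ 1])
  then show ?thesis
    by (simp add: E_r_def)
qed

end


section \<open>Maximum likelihood decoding\<close>

lemma log_likelihood_eq:
  assumes "\<And>i. i < n \<Longrightarrow> 0 \<le> w (x i) (y i)"
  shows "log_likelihood w n x y =
    (if (\<Prod>i<n. w (x i) (y i)) = 0 then -\<infinity> else ereal (ln (\<Prod>i<n. w (x i) (y i))))"
  using assms
proof (induction n)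
  case 0
  then show ?case
    by (simp add: log_likelihood_def zero_ereal_def)
next
  case (Suc n)
  then have IH: "log_likelihood w n x y =
      (if (\<Prod>i<n. w (x i) (y i)) = 0 then -\<infinity> else ereal (ln (\<Prod>i<n. w (x i) (y i))))"
    by simp
  have nonneg: "0 \<le> (\<Prod>i<n. w (x i) (y i))" "0 \<le> w (x n) (y n)"
    using Suc.prems by (auto intro!: prod_nonneg)
  have "log_likelihood w (Suc n) x y = log_likelihood w n x y +
      (if w (x n) (y n) = 0 then -\<infinity> else ereal (ln (w (x n) (y n))))"
    by (simp add: log_likelihood_def)
  also have "\<dots> = (if (\<Prod>i<Suc n. w (x i) (y i)) = 0 then -\<infinity> else ereal (ln (\<Prod>i<Suc n. w (x i) (y i))))"
    unfolding IH using nonneg by (auto simp: ln_mult)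
  finally show ?case .
qed

text \<open>The logarithm is increasing and -\<infinity> corresponds to likelihood 0, so the decoder
  may compare products of reals.\<close>

lemma log_likelihood_le_iff:
  assumes "\<And>i. i < n \<Longrightarrow> 0 \<le> w (x i) (y i)" "\<And>i. i < n \<Longrightarrow> 0 \<le> w (x' i) (y i)"
  shows "log_likelihood w n x y \<le> log_likelihood w n x' y \<longleftrightarrow>
    (\<Prod>i<n. w (x i) (y i)) \<le> (\<Prod>i<n. w (x' i) (y i))"
proof -
  define a b where "a = (\<Prod>i<n. w (x i) (y i))" and "b = (\<Prod>i<n. w (x' i) (y i))"
  have nonneg: "0 \<le> a" "0 \<le> b"
    using assms by (auto simp: a_def b_def intro!: prod_nonneg)
  have "log_likelihood w n x y = (if a = 0 then -\<infinity> else ereal (ln a))"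
    "log_likelihood w n x' y = (if b = 0 then -\<infinity> else ereal (ln b))"
    unfolding a_def b_def using assms by (intro log_likelihood_eq; simp)+
  with nonneg have "log_likelihood w n x y \<le> log_likelihood w n x' y \<longleftrightarrow> a \<le> b"
    by auto
  then show ?thesis
    unfolding a_def b_def .
qed

context singular_channel
begin

definition decoding_weight :: "nat \<Rightarrow> nat \<Rightarrow> (nat \<Rightarrow> nat \<Rightarrow> 'x) \<Rightarrow> (nat \<Rightarrow> 'y) \<Rightarrow> nat \<Rightarrow> real" where
  "decoding_weight M n c y j =
     (if \<forall>k\<in>{..<M}. (\<Prod>i<n. w (c k i) (y i)) \<le> (\<Prod>i<n. w (c j i) (y i)) then 1 else 0)"

text \<open>A visibly measurable form of the probability mass function of \<^const>\<open>decoder\<close>.\<close>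

definition decoding_prob :: "nat \<Rightarrow> nat \<Rightarrow> nat \<Rightarrow> (nat \<Rightarrow> nat \<Rightarrow> 'x) \<Rightarrow> (nat \<Rightarrow> 'y) \<Rightarrow> real" where
  "decoding_prob M n m c y = decoding_weight M n c y m / (\<Sum>j<M. decoding_weight M n c y j)"

context
  fixes M n :: nat
  assumes M: "0 < M"
begin

lemma decoding_prob_nonneg: "0 \<le> decoding_prob M n m c y"
  unfolding decoding_prob_def
  by (intro divide_nonneg_nonneg sum_nonneg) (auto simp: decoding_weight_def)

lemma decoding_prob_le_1:
  assumes "m < M"
  shows "decoding_prob M n m c y \<le> 1"
proof -
  have "decoding_weight M n c y m \<le> (\<Sum>j<M. decoding_weight M n c y j)"
    using assms by (intro member_le_sum) (auto simp: decoding_weight_def)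
  then show ?thesis
    unfolding decoding_prob_def
    by (cases "(\<Sum>j<M. decoding_weight M n c y j) = 0")
      (auto simp: divide_le_eq_1 decoding_weight_def intro!: sum_nonneg)
qed

lemma code_space:
  assumes "c \<in> space (random_code P M n)" "k < M" "i < n"
  shows "c k i \<in> space P"
  using assms by (auto simp: random_code_def space_PiM PiE_iff)

lemma output_space:
  assumes "y \<in> space (\<Pi>\<^sub>M i\<in>{..<n}. Q)" "i < n"
  shows "y i \<in> space Q"
  using assms by (auto simp: space_PiM PiE_iff)

lemma prob_decoder:
  assumes c: "c \<in> space (random_code P M n)" and y: "y \<in> space (\<Pi>\<^sub>M i\<in>{..<n}. Q)" and m: "m < M"
  shows "measure_pmf.prob (decoder w M n c y) {j. j \<noteq> m} = 1 - decoding_prob M n m c y"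
proof -
  let ?S = "ml_set w M n c y"
  have mem: "j \<in> ?S \<longleftrightarrow> j < M \<and> decoding_weight M n c y j = 1" for j
    using code_space[OF c] output_space[OF y] w_nonneg
    by (auto simp: ml_set_def decoding_weight_def log_likelihood_le_iff)
  have fin: "finite ?S"
    by (rule finite_subset[of _ "{..<M}"]) (auto simp: ml_set_def)
  let ?f = "\<lambda>k. \<Prod>i<n. w (c k i) (y i)"
  \<comment> \<open>\<open>pmf_of_set\<close> is meaningful only for a nonempty set; M > 0 supplies
    a maximizer.\<close>
  have "Max (?f ` {..<M}) \<in> ?f ` {..<M}"
    using M by (intro Max_in) auto
  then obtain j where j: "j < M" "Max (?f ` {..<M}) = ?f j"
    by auto
  then have "j \<in> ?S"
    unfolding mem decoding_weight_def using Max_ge[of "?f ` {..<M}"] by auto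
  then have ne: "?S \<noteq> {}"
    by auto
  have card: "real (card ?S) = (\<Sum>j<M. decoding_weight M n c y j)"
  proof -
    have "?S = {j \<in> {..<M}. decoding_weight M n c y j = 1}"
      using mem by auto
    then have "real (card ?S) = (\<Sum>j | j \<in> {..<M} \<and> decoding_weight M n c y j = 1. 1)"
      by simp
    also have "\<dots> = (\<Sum>j<M. decoding_weight M n c y j)"
      by (subst sum.inter_filter) (auto simp: decoding_weight_def intro!: sum.cong)
    finally show ?thesis .
  qed
  have "measure_pmf.prob (decoder w M n c y) {j. j \<noteq> m} = measure_pmf.prob (decoder w M n c y) (UNIV - {m})"
    by (rule arg_cong[where f="measure_pmf.prob _"]) auto
  also have "\<dots> = 1 - measure_pmf.prob (decoder w M n c y) {m}"
    using measure_pmf.prob_compl[of "{m}" "decoder w M n c y"] by simp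
  also have "measure_pmf.prob (decoder w M n c y) {m} = pmf (decoder w M n c y) m"
    by (simp add: measure_pmf_single)
  also have "\<dots> = indicator ?S m / card ?S"
    unfolding decoder_def using ne fin by (rule pmf_of_set)
  also have "\<dots> = decoding_prob M n m c y"
    unfolding decoding_prob_def card
    using m by (auto simp: mem indicator_def decoding_weight_def)
  finally show ?thesis .
qed

lemma likelihood_measurable [measurable]:
  assumes k: "k < M"
  shows "(\<lambda>z. \<Prod>i<n. w (fst z k i) (snd z i)) \<in> borel_measurable (random_code P M n \<Otimes>\<^sub>M (\<Pi>\<^sub>M i\<in>{..<n}. Q))"
proof (intro borel_measurable_prod w_measurable_compose)
  fix i assume i: "i \<in> {..<n}"
  have "(\<lambda>c. c k) \<in> measurable (random_code P M n) (\<Pi>\<^sub>M i\<in>{..<n}. P)"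
    unfolding random_code_def using k by (intro measurable_component_singleton) auto
  then have "(\<lambda>c. c k i) \<in> measurable (random_code P M n) P"
    using i by (rule measurable_compose[OF _ measurable_component_singleton])
  then show "(\<lambda>z. fst z k i) \<in> measurable (random_code P M n \<Otimes>\<^sub>M (\<Pi>\<^sub>M i\<in>{..<n}. Q)) P"
    by measurable
  show "(\<lambda>z. snd z i) \<in> measurable (random_code P M n \<Otimes>\<^sub>M (\<Pi>\<^sub>M i\<in>{..<n}. Q)) Q"
    using i by measurable
qed

lemma decoding_prob_measurable [measurable]:
  assumes m: "m < M"
  shows "(\<lambda>z. decoding_prob M n m (fst z) (snd z)) \<in> borel_measurable (random_code P M n \<Otimes>\<^sub>M (\<Pi>\<^sub>M i\<in>{..<n}. Q))"
proof -
  have [measurable]: "(\<lambda>z. decoding_weight M n (fst z) (snd z) j)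
      \<in> borel_measurable (random_code P M n \<Otimes>\<^sub>M (\<Pi>\<^sub>M i\<in>{..<n}. Q))" if "j < M" for j
    unfolding decoding_weight_def using that
    by (intro measurable_If sets.sets_Collect_finite_All borel_measurable_le likelihood_measurable) auto
  show ?thesis
    unfolding decoding_prob_def using m
    by (intro borel_measurable_divide borel_measurable_sum) auto
qed

text \<open>The output law is unfolded to its density and the value kept in \<open>ennreal\<close>,
  so that sums and orders of integration can be exchanged without integrability conditions.\<close>

definition correct_prob :: "(nat \<Rightarrow> nat \<Rightarrow> 'x) \<Rightarrow> nat \<Rightarrow> ennreal" where
  "correct_prob c m = (\<integral>\<^sup>+y. ennreal (decoding_prob M n m c y * (\<Prod>i<n. w (c m i) (y i))) \<partial>(\<Pi>\<^sub>M i\<in>{..<n}. Q))"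

interpretation Qn: finite_product_sigma_finite "\<lambda>_. Q" "{..<n}"
  by unfold_locales auto

interpretation RC: prob_space "random_code P M n"
  unfolding random_code_def by (intro prob_space_PiM P.prob_space_axioms)

interpretation RCQ: pair_sigma_finite "random_code P M n" "\<Pi>\<^sub>M i\<in>{..<n}. Q" ..

lemma correct_prob_measurable [measurable]:
  assumes "m < M"
  shows "(\<lambda>c. correct_prob c m) \<in> borel_measurable (random_code P M n)"
proof -
  have "(\<lambda>z. ennreal (decoding_prob M n m (fst z) (snd z) * (\<Prod>i<n. w (fst z m i) (snd z i))))
      \<in> borel_measurable (random_code P M n \<Otimes>\<^sub>M (\<Pi>\<^sub>M i\<in>{..<n}. Q))"
    using assms by measurable
  from Qn.borel_measurable_nn_integral_fst[OF this] show ?thesis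
    by (simp add: correct_prob_def)
qed

lemma error_prob_eq:
  assumes c: "c \<in> space (random_code P M n)" and m: "m < M"
  shows "error_prob Q w M n c m = 1 - enn2real (correct_prob c m)" and "correct_prob c m \<le> 1"
proof -
  have cm: "c m i \<in> space P" if "i < n" for i
    using code_space[OF c m that] .
  let ?W = "\<Pi>\<^sub>M i\<in>{..<n}. output_dist Q w (c m i)"
  interpret W: prob_space ?W
    using cm prob_space_output_dist by (intro prob_space_PiM) auto
  have dens: "?W = density (\<Pi>\<^sub>M i\<in>{..<n}. Q) (\<lambda>y. \<Prod>i<n. ennreal (w (c m i) (y i)))"
    unfolding output_dist_def
  proof (rule PiM_density)
    fix i assume "i \<in> {..<n}"
    then have i: "c m i \<in> space P"
      using cm by simp
    from i show "(\<lambda>y. ennreal (w (c m i) y)) \<in> borel_measurable Q"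
      by measurable
    interpret Wi: prob_space "output_dist Q w (c m i)"
      using i by (rule prob_space_output_dist)
    show "sigma_finite_measure (density Q (\<lambda>y. ennreal (w (c m i) y)))"
      using Wi.sigma_finite_measure_axioms by (simp add: output_dist_def)
  qed (auto simp: Q.sigma_finite_measure_axioms)
  have sets_W [measurable_cong]: "sets ?W = sets (\<Pi>\<^sub>M i\<in>{..<n}. Q)"
    by (simp add: dens)
  have space_W: "space ?W = space (\<Pi>\<^sub>M i\<in>{..<n}. Q)"
    by (rule sets_eq_imp_space_eq) (rule sets_W)
  have D [measurable]: "decoding_prob M n m c \<in> borel_measurable (\<Pi>\<^sub>M i\<in>{..<n}. Q)"
    using measurable_compose[OF measurable_Pair1'[OF c] decoding_prob_measurable[OF m]] by simp
  have L [measurable]: "(\<lambda>y. \<Prod>i<n. ennreal (w (c m i) (y i))) \<in> borel_measurable (\<Pi>\<^sub>M i\<in>{..<n}. Q)"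
    using cm by (intro borel_measurable_prod_ennreal) (auto intro!: measurable_compose[OF _ measurable_ennreal] w_measurable_compose)
  have D_int: "integrable ?W (decoding_prob M n m c)"
    using decoding_prob_nonneg decoding_prob_le_1[OF m] by (intro W.integrable_const_bound[where B=1]) auto
  have "(\<integral>\<^sup>+y. ennreal (decoding_prob M n m c y) \<partial>?W) = correct_prob c m"
    unfolding dens correct_prob_def
  proof (subst nn_integral_density, goal_cases)
    case 3
    show ?case
    proof (intro nn_integral_cong)
      fix y assume y: "y \<in> space (\<Pi>\<^sub>M i\<in>{..<n}. Q)"
      have "(\<Prod>i<n. ennreal (w (c m i) (y i))) = ennreal (\<Prod>i<n. w (c m i) (y i))"
        using cm output_space[OF y] w_nonneg by (intro prod_ennreal) auto
      then show "(\<Prod>i<n. ennreal (w (c m i) (y i))) * ennreal (decoding_prob M n m c y) =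
          ennreal (decoding_prob M n m c y * (\<Prod>i<n. w (c m i) (y i)))"
        using decoding_prob_nonneg by (simp add: ennreal_mult' mult.commute)
    qed
  qed simp_all
  then have val: "correct_prob c m = ennreal (W.expectation (decoding_prob M n m c))"
    using nn_integral_eq_integral[OF D_int] decoding_prob_nonneg by simp
  have "W.expectation (decoding_prob M n m c) \<le> W.expectation (\<lambda>_. 1)"
    using D_int decoding_prob_le_1[OF m] by (intro integral_mono) auto
  then show "correct_prob c m \<le> 1"
    by (simp add: val W.prob_space)
  have "error_prob Q w M n c m = W.expectation (\<lambda>y. 1 - decoding_prob M n m c y)"
    unfolding error_prob_def
    by (intro Bochner_Integration.integral_cong refl) (simp add: prob_decoder[OF c _ m] space_W)
  also have "\<dots> = 1 - W.expectation (decoding_prob M n m c)"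
    using D_int by (simp add: W.prob_space)
  finally show "error_prob Q w M n c m = 1 - enn2real (correct_prob c m)"
    using decoding_prob_nonneg by (simp add: val)
qed

lemma integral_error_prob:
  assumes m: "m < M"
  shows "ennreal (1 - (\<integral>c. error_prob Q w M n c m \<partial>random_code P M n)) = (\<integral>\<^sup>+c. correct_prob c m \<partial>random_code P M n)"
    and "(\<integral>c. error_prob Q w M n c m \<partial>random_code P M n) \<le> 1"
proof -
  let ?g = "\<lambda>c. enn2real (correct_prob c m)"
  have g_le: "?g c \<le> 1" if "c \<in> space (random_code P M n)" for c
    using error_prob_eq(2)[OF that m] enn2real_mono[of "correct_prob c m" 1] by simp
  have int: "integrable (random_code P M n) ?g"
    using g_le m by (intro RC.integrable_const_bound[where B=1]) auto
  have "(\<integral>c. error_prob Q w M n c m \<partial>random_code P M n) = RC.expectation (\<lambda>c. 1 - ?g c)"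
    using error_prob_eq(1)[OF _ m] by (intro Bochner_Integration.integral_cong) auto
  also have "\<dots> = 1 - RC.expectation ?g"
    using int by (simp add: RC.prob_space)
  finally have eq: "(\<integral>c. error_prob Q w M n c m \<partial>random_code P M n) = 1 - RC.expectation ?g" .
  have "ennreal (RC.expectation ?g) = (\<integral>\<^sup>+c. ennreal (?g c) \<partial>random_code P M n)"
    using int by (intro nn_integral_eq_integral[symmetric]) auto
  also have "\<dots> = (\<integral>\<^sup>+c. correct_prob c m \<partial>random_code P M n)"
  proof (intro nn_integral_cong)
    fix c assume "c \<in> space (random_code P M n)"
    from error_prob_eq(2)[OF this m] have "correct_prob c m < top"
      by (rule le_less_trans) simp
    then show "ennreal (?g c) = correct_prob c m"
      by simp
  qed
  finally show "ennreal (1 - (\<integral>c. error_prob Q w M n c m \<partial>random_code P M n)) = (\<integral>\<^sup>+c. correct_prob c m \<partial>random_code P M n)"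
    by (simp add: eq)
  show "(\<integral>c. error_prob Q w M n c m \<partial>random_code P M n) \<le> 1"
    unfolding eq by (simp add: integral_nonneg_AE)
qed

section \<open>Exact error probability averaged over the random code\<close>

definition max_likelihood :: "(nat \<Rightarrow> nat \<Rightarrow> 'x) \<Rightarrow> (nat \<Rightarrow> 'y) \<Rightarrow> real" where
  "max_likelihood c y = (\<Sum>m<M. decoding_prob M n m c y * (\<Prod>i<n. w (c m i) (y i)))"

text \<open>Only maximizers carry weight, they share one likelihood, and their weights add up to 1;
  thus the sum over messages is the maximal likelihood and the tie-breaking is gone.\<close>

lemma max_likelihood_attained:
  obtains j where "j < M" "max_likelihood c y = (\<Prod>i<n. w (c j i) (y i))"
    "\<And>k. k < M \<Longrightarrow> (\<Prod>i<n. w (c k i) (y i)) \<le> max_likelihood c y"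
proof -
  let ?f = "\<lambda>k. \<Prod>i<n. w (c k i) (y i)"
  let ?d = "decoding_weight M n c y"
  have "Max (?f ` {..<M}) \<in> ?f ` {..<M}"
    using M by (intro Max_in) auto
  then obtain j where j: "j < M" "Max (?f ` {..<M}) = ?f j"
    by auto
  then have le: "?f k \<le> ?f j" if "k < M" for k
    using Max_ge[of "?f ` {..<M}" "?f k"] that by auto
  have "?d j \<le> (\<Sum>k<M. ?d k)"
    using j(1) by (intro member_le_sum) (auto simp: decoding_weight_def)
  moreover have "?d j = 1"
    using le by (auto simp: decoding_weight_def)
  ultimately have pos: "0 < (\<Sum>k<M. ?d k)"
    by simp
  have "?d m * ?f m = ?d m * ?f j" if "m < M" for m
    using le[OF that] j(1) by (auto simp: decoding_weight_def intro: antisym)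
  then have "max_likelihood c y = (\<Sum>m<M. ?d m / (\<Sum>k<M. ?d k) * ?f j)"
    unfolding max_likelihood_def decoding_prob_def by (intro sum.cong) auto
  also have "\<dots> = ?f j"
    using pos by (simp flip: sum_distrib_right sum_divide_distrib)
  finally show ?thesis
    using that[of j] j(1) le by simp
qed

text \<open>Moves the output outside the average over codes, so that for fixed y the codewords
  become independent trials.\<close>

lemma sum_correct_prob:
  "(\<Sum>m<M. \<integral>\<^sup>+c. correct_prob c m \<partial>random_code P M n) =
    (\<integral>\<^sup>+y. (\<integral>\<^sup>+c. ennreal (max_likelihood c y) \<partial>random_code P M n) \<partial>(\<Pi>\<^sub>M i\<in>{..<n}. Q))"
proof -
  have meas: "(\<lambda>z. ennreal (decoding_prob M n m (fst z) (snd z) * (\<Prod>i<n. w (fst z m i) (snd z i))))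
      \<in> borel_measurable (random_code P M n \<Otimes>\<^sub>M (\<Pi>\<^sub>M i\<in>{..<n}. Q))" if "m < M" for m
    using that by measurable
  have meas_y: "(\<lambda>y. ennreal (decoding_prob M n m c y * (\<Prod>i<n. w (c m i) (y i)))) \<in> borel_measurable (\<Pi>\<^sub>M i\<in>{..<n}. Q)"
    if "m < M" "c \<in> space (random_code P M n)" for m c
    using measurable_compose[OF measurable_Pair1'[OF that(2)] meas[OF that(1)]] by simp
  have "(\<Sum>m<M. \<integral>\<^sup>+c. correct_prob c m \<partial>random_code P M n) = (\<integral>\<^sup>+c. (\<Sum>m<M. correct_prob c m) \<partial>random_code P M n)"
    by (intro nn_integral_sum[symmetric]) auto
  also have "\<dots> = (\<integral>\<^sup>+c. (\<integral>\<^sup>+y. ennreal (max_likelihood c y) \<partial>(\<Pi>\<^sub>M i\<in>{..<n}. Q)) \<partial>random_code P M n)"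
  proof (intro nn_integral_cong)
    fix c assume c: "c \<in> space (random_code P M n)"
    have "(\<Sum>m<M. correct_prob c m) = (\<integral>\<^sup>+y. (\<Sum>m<M. ennreal (decoding_prob M n m c y * (\<Prod>i<n. w (c m i) (y i)))) \<partial>(\<Pi>\<^sub>M i\<in>{..<n}. Q))"
      unfolding correct_prob_def using meas_y[OF _ c] by (intro nn_integral_sum[symmetric]) auto
    also have "\<dots> = (\<integral>\<^sup>+y. ennreal (max_likelihood c y) \<partial>(\<Pi>\<^sub>M i\<in>{..<n}. Q))"
      unfolding max_likelihood_def
    proof (intro nn_integral_cong sum_ennreal)
      fix y m assume "y \<in> space (\<Pi>\<^sub>M i\<in>{..<n}. Q)" "m \<in> {..<M}"
      then show "0 \<le> decoding_prob M n m c y * (\<Prod>i<n. w (c m i) (y i))"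
        using code_space[OF c] output_space w_nonneg decoding_prob_nonneg
        by (intro mult_nonneg_nonneg prod_nonneg) auto
    qed
    finally show "(\<Sum>m<M. correct_prob c m) = (\<integral>\<^sup>+y. ennreal (max_likelihood c y) \<partial>(\<Pi>\<^sub>M i\<in>{..<n}. Q))" .
  qed
  also have "\<dots> = (\<integral>\<^sup>+y. (\<integral>\<^sup>+c. ennreal (max_likelihood c y) \<partial>random_code P M n) \<partial>(\<Pi>\<^sub>M i\<in>{..<n}. Q))"
  proof (rule RCQ.Fubini'[symmetric])
    have "(\<lambda>z. max_likelihood (fst z) (snd z)) \<in> borel_measurable (random_code P M n \<Otimes>\<^sub>M (\<Pi>\<^sub>M i\<in>{..<n}. Q))"
      unfolding max_likelihood_def by measurable
    then show "(\<lambda>(c, y). ennreal (max_likelihood c y)) \<in> borel_measurable (random_code P M n \<Otimes>\<^sub>M (\<Pi>\<^sub>M i\<in>{..<n}. Q))"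
      by (simp add: case_prod_beta)
  qed
  finally show ?thesis .
qed

text \<open>Every compatible codeword has the same likelihood, the product of the common densities;
  so the maximum is this product unless all M independent codewords are incompatible.\<close>

lemma nn_integral_max_likelihood:
  assumes y: "y \<in> space (\<Pi>\<^sub>M i\<in>{..<n}. Q)"
    and good: "\<And>i. i < n \<Longrightarrow> AE x in P. w x (y i) \<in> {0, common_density (y i)}"
  shows "(\<integral>\<^sup>+c. ennreal (max_likelihood c y) \<partial>random_code P M n) =
    ennreal ((\<Prod>i<n. common_density (y i)) * (1 - (1 - (\<Prod>i<n. support_prob (y i))) ^ M))"
proof -
  have yi: "y i \<in> space Q" if "i < n" for i
    using output_space[OF y that] .
  interpret Pn: finite_product_prob_space "\<lambda>_. P" "{..<n}"
    by unfold_locales auto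
  interpret RCP: finite_product_prob_space "\<lambda>_. \<Pi>\<^sub>M i\<in>{..<n}. P" "{..<M}"
    by (intro finite_product_prob_space.intro finite_product_sigma_finite.intro
        product_prob_spaceI Pn.prob_space_axioms) (unfold_locales, auto)
  let ?v = "\<Prod>i<n. common_density (y i)"
  let ?A = "\<lambda>i. {x \<in> space P. w x (y i) \<noteq> 0}"
  let ?B = "\<Pi>\<^sub>E i\<in>{..<n}. ?A i"
  have v0: "0 \<le> ?v"
    using yi by (intro prod_nonneg) (auto simp: common_density_nonneg)
  have A: "?A i \<in> sets P" if "i < n" for i
    using yi[OF that] by measurable
  have B [measurable]: "?B \<in> sets (\<Pi>\<^sub>M i\<in>{..<n}. P)"
    using A by (intro sets_PiM_I_finite) auto
  have PB: "measure (\<Pi>\<^sub>M i\<in>{..<n}. P) ?B = (\<Prod>i<n. support_prob (y i))"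
    using A yi by (subst Pn.prob_times) (auto simp: support_prob_eq_prob)
  \<comment> \<open>The event that no codeword is compatible with y.\<close>
  let ?C = "\<Pi>\<^sub>E k\<in>{..<M}. space (\<Pi>\<^sub>M i\<in>{..<n}. P) - ?B"
  have C [measurable]: "?C \<in> sets (random_code P M n)"
    unfolding random_code_def by (intro sets_PiM_I_finite) auto
  have PC: "RC.prob ?C = (1 - (\<Prod>i<n. support_prob (y i))) ^ M"
    unfolding random_code_def by (subst RCP.prob_times) (auto simp: PB Pn.prob_compl)
  have "AE c in random_code P M n. \<forall>k\<in>{..<M}. \<forall>i\<in>{..<n}. w (c k i) (y i) \<in> {0, common_density (y i)}"
  proof (intro AE_finite_allI finite_lessThan)
    fix k i assume ki: "k \<in> {..<M}" "i \<in> {..<n}"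
    have "AE x in \<Pi>\<^sub>M i\<in>{..<n}. P. w (x i) (y i) \<in> {0, common_density (y i)}"
      using good ki by (intro AE_PiM_component) (auto simp: P.prob_space_axioms)
    then show "AE c in random_code P M n. w (c k i) (y i) \<in> {0, common_density (y i)}"
      unfolding random_code_def using ki
      by (intro AE_PiM_component[where P="\<lambda>x. w (x i) (y i) \<in> {0, common_density (y i)}"]) (auto simp: Pn.prob_space_axioms)
  qed
  then have "AE c in random_code P M n. ennreal (max_likelihood c y) = ennreal ?v * indicator (space (random_code P M n) - ?C) c"
    using AE_space
  proof eventually_elim
    case (elim c)
    have c_space: "c k \<in> space (\<Pi>\<^sub>M i\<in>{..<n}. P)" if "k < M" for k
      using elim(2) that by (auto simp: random_code_def space_PiM PiE_iff)
    have B_iff: "c k \<in> ?B \<longleftrightarrow> (\<Prod>i<n. w (c k i) (y i)) \<noteq> 0" if "k < M" for k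
      using c_space[OF that] by (auto simp: space_PiM PiE_iff)
    have val: "(\<Prod>i<n. w (c k i) (y i)) = ?v" if "k < M" "(\<Prod>i<n. w (c k i) (y i)) \<noteq> 0" for k
    proof (intro prod.cong refl)
      fix i assume "i \<in> {..<n}"
      with that(2) have "w (c k i) (y i) \<noteq> 0"
        by auto
      with elim(1) that(1) \<open>i \<in> {..<n}\<close> show "w (c k i) (y i) = common_density (y i)"
        by auto
    qed
    obtain j where j: "j < M" "max_likelihood c y = (\<Prod>i<n. w (c j i) (y i))"
      "\<And>k. k < M \<Longrightarrow> (\<Prod>i<n. w (c k i) (y i)) \<le> max_likelihood c y"
      using max_likelihood_attained[of c y] by blast
    have nonneg: "0 \<le> (\<Prod>i<n. w (c k i) (y i))" if "k < M" for k
      using code_space[OF elim(2) that] yi w_nonneg by (intro prod_nonneg) auto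
    have C_iff: "c \<in> ?C \<longleftrightarrow> (\<forall>k<M. c k \<notin> ?B)"
      using elim(2) c_space by (auto simp: random_code_def space_PiM[of "{..<M}"] PiE_iff[of _ "{..<M}"])
    show ?case
    proof (cases "c \<in> ?C")
      case True
      then have "c j \<notin> ?B"
        using C_iff j(1) by blast
      then have "max_likelihood c y = 0"
        unfolding B_iff[OF j(1)] j(2) by blast
      with True show ?thesis
        by simp
    next
      case False
      then obtain k where k: "k < M" "(\<Prod>i<n. w (c k i) (y i)) \<noteq> 0"
        using B_iff C_iff by auto
      with j(3)[of k] nonneg[of k] have "max_likelihood c y \<noteq> 0"
        by linarith
      with j val have "max_likelihood c y = ?v"
        by simp
      with False elim(2) show ?thesis
        by simp
    qed
  qed
  then have "(\<integral>\<^sup>+c. ennreal (max_likelihood c y) \<partial>random_code P M n) =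
      (\<integral>\<^sup>+c. ennreal ?v * indicator (space (random_code P M n) - ?C) c \<partial>random_code P M n)"
    by (rule nn_integral_cong_AE)
  also have "\<dots> = ennreal ?v * emeasure (random_code P M n) (space (random_code P M n) - ?C)"
    by (subst nn_integral_cmult_indicator) auto
  also have "\<dots> = ennreal (?v * (1 - (1 - (\<Prod>i<n. support_prob (y i))) ^ M))"
    using v0 by (simp add: RC.emeasure_eq_measure RC.prob_compl PC ennreal_mult')
  finally show ?thesis .
qed

lemma AE_common_density_prod:
  "AE y in \<Pi>\<^sub>M i\<in>{..<n}. Q. \<forall>i\<in>{..<n}. AE x in P. w x (y i) \<in> {0, common_density (y i)}"
  using Qn.AE_PiM_finite_component[OF finite_lessThan _ AE_common_density]
  by (intro AE_finite_allI finite_lessThan) auto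

text \<open>The output density is the common density times q, which cancels the q in the denominator
  of \<open>tie_error\<close> and leaves the expression of \<open>nn_integral_max_likelihood\<close>
  divided by M.\<close>

lemma output_product_tie_error:
  "ennreal (1 - O.expected_tie_error (\<lambda>_. M) n) =
    (\<integral>\<^sup>+y. ennreal ((\<Prod>i<n. common_density (y i)) * (1 - (1 - (\<Prod>i<n. support_prob (y i))) ^ M) / real M) \<partial>(\<Pi>\<^sub>M i\<in>{..<n}. Q))"
  and expected_tie_error_le_1: "O.expected_tie_error (\<lambda>_. M) n \<le> 1"
proof -
  interpret On: prob_space "\<Pi>\<^sub>M i\<in>{..<n}. output_measure"
    by (intro prob_space_PiM O.prob_space_axioms)
  have dens: "(\<Pi>\<^sub>M i\<in>{..<n}. output_measure) =
      density (\<Pi>\<^sub>M i\<in>{..<n}. Q) (\<lambda>y. \<Prod>i<n. ennreal (output_density (y i)))"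
    unfolding output_measure_def
    by (rule PiM_density) (auto simp: Q.sigma_finite_measure_axioms output_measure_def[symmetric] O.sigma_finite_measure_axioms)
  let ?T = "\<lambda>y. tie_error M (exp (- (\<Sum>i<n. info (y i))))"
  have T_le: "?T y \<le> 1" if "y \<in> space (\<Pi>\<^sub>M i\<in>{..<n}. output_measure)" for y
    using O.sum_V_nonneg[OF that] M by (intro tie_error_le_1) auto
  have T_int: "integrable (\<Pi>\<^sub>M i\<in>{..<n}. output_measure) ?T"
    by (rule O.integrable_tie_error[OF M])
  have eq: "1 - O.expected_tie_error (\<lambda>_. M) n = On.expectation (\<lambda>y. 1 - ?T y)"
    using T_int by (simp add: O.expected_tie_error_def On.prob_space)
  have "0 \<le> On.expectation (\<lambda>y. 1 - ?T y)"
    using T_le by (intro integral_nonneg_AE AE_I2) auto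
  then show "O.expected_tie_error (\<lambda>_. M) n \<le> 1"
    using eq by simp
  have "ennreal (1 - O.expected_tie_error (\<lambda>_. M) n) = (\<integral>\<^sup>+y. ennreal (1 - ?T y) \<partial>(\<Pi>\<^sub>M i\<in>{..<n}. output_measure))"
    unfolding eq using T_le T_int by (intro nn_integral_eq_integral[symmetric]) auto
  also have "\<dots> = (\<integral>\<^sup>+y. (\<Prod>i<n. ennreal (output_density (y i))) * ennreal (1 - ?T y) \<partial>(\<Pi>\<^sub>M i\<in>{..<n}. Q))"
    unfolding dens by (subst nn_integral_density) auto
  also have "\<dots> = (\<integral>\<^sup>+y. ennreal ((\<Prod>i<n. common_density (y i)) * (1 - (1 - (\<Prod>i<n. support_prob (y i))) ^ M) / real M) \<partial>(\<Pi>\<^sub>M i\<in>{..<n}. Q))"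
  proof (intro nn_integral_cong)
    fix y assume y: "y \<in> space (\<Pi>\<^sub>M i\<in>{..<n}. Q)"
    let ?q = "\<Prod>i<n. support_prob (y i)"
    let ?v = "\<Prod>i<n. common_density (y i)"
    have p0: "0 \<le> (\<Prod>i<n. output_density (y i))"
      using output_space[OF y] by (intro prod_nonneg) (auto simp: output_density_nonneg)
    have p: "(\<Prod>i<n. output_density (y i)) = ?v * ?q"
      using output_space[OF y] by (simp add: common_times_support flip: prod.distrib)
    have "(\<Prod>i<n. output_density (y i)) * (1 - ?T y) = ?v * (1 - (1 - ?q) ^ M) / real M"
    proof (cases "?q = 0")
      \<comment> \<open>Both sides are 0 here: the output density vanishes on the left, and 1 - (1 -
        0)^M on the right.\<close>
      case True
      show ?thesis
        unfolding p True by simp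
    next
      case False
      then have "exp (- (\<Sum>i<n. info (y i))) = ?q"
        by (auto simp: exp_sum exp_minus_info simp flip: sum_negf)
      with False show ?thesis
        by (simp add: p tie_error_def)
    qed
    moreover have "(\<Prod>i<n. ennreal (output_density (y i))) = ennreal (\<Prod>i<n. output_density (y i))"
      using output_space[OF y] by (intro prod_ennreal) (auto simp: output_density_nonneg)
    ultimately show "(\<Prod>i<n. ennreal (output_density (y i))) * ennreal (1 - ?T y) =
        ennreal (?v * (1 - (1 - ?q) ^ M) / real M)"
      using p0 by (simp add: ennreal_mult'[symmetric])
  qed
  finally show "ennreal (1 - O.expected_tie_error (\<lambda>_. M) n) =
    (\<integral>\<^sup>+y. ennreal ((\<Prod>i<n. common_density (y i)) * (1 - (1 - (\<Prod>i<n. support_prob (y i))) ^ M) / real M) \<partial>(\<Pi>\<^sub>M i\<in>{..<n}. Q))" .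
qed

text \<open>The comparison is made for correct decoding in \<open>ennreal\<close>; since all errors
  are at most 1, injectivity of the embedding brings it back to the reals.\<close>

lemma average_error_eq:
  "(\<Sum>m<M. \<integral>c. error_prob Q w M n c m \<partial>random_code P M n) / real M = O.expected_tie_error (\<lambda>_. M) n"
proof -
  let ?e = "\<lambda>m. \<integral>c. error_prob Q w M n c m \<partial>random_code P M n"
  let ?F = "\<lambda>y. (\<Prod>i<n. common_density (y i)) * (1 - (1 - (\<Prod>i<n. support_prob (y i))) ^ M)"
  have F: "ennreal (?F y) = ennreal (real M) * ennreal (?F y / real M)" for y
    using M by (simp add: ennreal_mult'[symmetric])
  have F_meas: "(\<lambda>y. ennreal (?F y / real M)) \<in> borel_measurable (\<Pi>\<^sub>M i\<in>{..<n}. Q)"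
  proof -
    show ?thesis
      by measurable
  qed
  have "ennreal (\<Sum>m<M. 1 - ?e m) = (\<Sum>m<M. ennreal (1 - ?e m))"
    using integral_error_prob(2) by (intro sum_ennreal[symmetric]) auto
  also have "\<dots> = (\<Sum>m<M. \<integral>\<^sup>+c. correct_prob c m \<partial>random_code P M n)"
    using integral_error_prob(1) by (intro sum.cong) auto
  also have "\<dots> = (\<integral>\<^sup>+y. ennreal (real M) * ennreal (?F y / real M) \<partial>(\<Pi>\<^sub>M i\<in>{..<n}. Q))"
    unfolding sum_correct_prob
  proof (rule nn_integral_cong_AE)
    show "AE y in \<Pi>\<^sub>M i\<in>{..<n}. Q. (\<integral>\<^sup>+c. ennreal (max_likelihood c y) \<partial>random_code P M n) =
        ennreal (real M) * ennreal (?F y / real M)"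
      using AE_common_density_prod AE_space
    proof eventually_elim
      case (elim y)
      then show ?case
        using nn_integral_max_likelihood[of y] unfolding F[symmetric] by auto
    qed
  qed
  also have "\<dots> = ennreal (real M) * ennreal (1 - O.expected_tie_error (\<lambda>_. M) n)"
    unfolding output_product_tie_error by (rule nn_integral_cmult[OF F_meas])
  also have "\<dots> = ennreal (real M * (1 - O.expected_tie_error (\<lambda>_. M) n))"
    by (simp add: ennreal_mult')
  finally have "(\<Sum>m<M. 1 - ?e m) = real M * (1 - O.expected_tie_error (\<lambda>_. M) n)"
    using integral_error_prob(2) expected_tie_error_le_1
    by (subst (asm) ennreal_inj) (auto intro!: sum_nonneg)
  then have "(\<Sum>m<M. ?e m) = real M * O.expected_tie_error (\<lambda>_. M) n"
    by (simp add: sum_subtractf algebra_simps)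
  with M show ?thesis
    by simp
qed

end

lemma num_codewords_bounds:
  "exp (real n * R) \<le> real (num_codewords R n)" "real (num_codewords R n) \<le> exp (real n * R) + 1"
proof -
  have "0 < exp (real n * R)"
    by simp
  then have "0 \<le> \<lceil>exp (real n * R)\<rceil>"
    by linarith
  then have "real (num_codewords R n) = of_int \<lceil>exp (real n * R)\<rceil>"
    unfolding num_codewords_def by (rule of_nat_nat)
  then show "exp (real n * R) \<le> real (num_codewords R n)" "real (num_codewords R n) \<le> exp (real n * R) + 1"
    by linarith+
qed

lemma P_RC_eq: "P_RC P Q w R n = O.expected_tie_error (num_codewords R) n"
proof -
  have "0 < num_codewords R n"
    by (simp add: num_codewords_def)
  from average_error_eq[OF this, of n] show ?thesis
    by (simp add: P_RC_def Let_def O.expected_tie_error_def)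
qed

text \<open>The minimum being at 1, the normaliser is exactly the exponential of -n E_r, so
  \<epsilon> is the ratio minus its limit.\<close>

lemma P_RC_asymptotics:
  assumes R: "R \<le> O.tilted_mean"
    and lim: "(\<lambda>n. O.expected_tie_error (num_codewords R) n / (exp (real n * R) * O.laplace 1 ^ n)) \<longlonglongrightarrow> a"
  shows "\<exists>\<epsilon>. \<epsilon> \<longlonglongrightarrow> 0 \<and> (\<forall>n. P_RC P Q w R n = (a + \<epsilon> n) * exp (- real n * E_r P Q w R))"
proof (intro exI conjI allI)
  let ?r = "\<lambda>n. O.expected_tie_error (num_codewords R) n / (exp (real n * R) * O.laplace 1 ^ n)"
  show "(\<lambda>n. ?r n - a) \<longlonglongrightarrow> 0"
    using lim by (simp add: LIM_zero)
  fix n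
  have pos: "0 < O.laplace 1"
    by (simp add: O.laplace_pos)
  have "exp (- real n * E_r P Q w R) = exp (real n * R + real n * ln (O.laplace 1))"
    by (simp add: E_r_eq[OF R] algebra_simps)
  also have "\<dots> = exp (real n * R) * O.laplace 1 ^ n"
    using pos unfolding exp_add exp_of_nat_mult[of n "ln (O.laplace 1)"] by simp
  finally have "exp (- real n * E_r P Q w R) = exp (real n * R) * O.laplace 1 ^ n" .
  with pos show "P_RC P Q w R n = (a + (?r n - a)) * exp (- real n * E_r P Q w R)"
    by (simp add: P_RC_eq)
qed

end

theorem theorem3:
  fixes P :: "'x measure" and Q :: "'y measure" and w :: "'x \<Rightarrow> 'y \<Rightarrow> real" and h R :: real
  assumes "channel_with_input P Q w"
    and "finite_mutual_info P Q w"
    and "singular P Q w"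
    and "has_lattice_span P Q w h"
    and "0 < R" and "R < mutual_info P Q w" and "R \<le> R_crit P Q w"
    and "regular P Q w h R"
  shows "(R < R_crit P Q w \<longrightarrow>
           (\<exists>\<epsilon>. \<epsilon> \<longlonglongrightarrow> 0 \<and>
              (\<forall>n. P_RC P Q w R n = (1 / 2 + \<epsilon> n) * exp (- real n * E_r P Q w R)))) \<and>
         (R = R_crit P Q w \<longrightarrow>
           (\<exists>\<epsilon>. \<epsilon> \<longlonglongrightarrow> 0 \<and>
              (\<forall>n. P_RC P Q w R n = (1 / 4 + \<epsilon> n) * exp (- real n * E_r P Q w R))))"
proof -
  interpret singular_channel P Q w
    by unfold_locales fact+
  have R_crit: "R_crit P Q w =
      (if mutual_info P Q w \<le> O.tilted_mean then mutual_info P Q w else O.tilted_mean)"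
    using assms by (intro R_crit_cases) auto
  show ?thesis
  proof (intro conjI impI)
    assume "R < R_crit P Q w"
    \<comment> \<open>Either branch of the critical rate is at most the tilted mean.\<close>
    then have "R < O.tilted_mean"
      by (auto simp: R_crit split: if_splits)
    with \<open>0 < R\<close> show "\<exists>\<epsilon>. \<epsilon> \<longlonglongrightarrow> 0 \<and>
        (\<forall>n. P_RC P Q w R n = (1 / 2 + \<epsilon> n) * exp (- real n * E_r P Q w R))"
      by (intro P_RC_asymptotics O.expected_tie_error_below_tilted_mean num_codewords_bounds) auto
  next
    assume "R = R_crit P Q w"
    \<comment> \<open>R < I(X;Y) rules out the branch in which the critical rate is I(X;Y).\<close>
    with \<open>R < mutual_info P Q w\<close> have R: "R = O.tilted_mean"
      by (auto simp: R_crit split: if_splits)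
    have "\<not> (AE y in output_measure. info y = R)"
    proof
      assume "AE y in output_measure. info y = R"
      then have "O.expectation info = O.expectation (\<lambda>_. R)"
        by (intro integral_cong_AE) auto
      with \<open>R < mutual_info P Q w\<close> show False
        by (simp add: mutual_info_eq O.prob_space)
    qed
    with R \<open>0 < R\<close> show "\<exists>\<epsilon>. \<epsilon> \<longlonglongrightarrow> 0 \<and>
        (\<forall>n. P_RC P Q w R n = (1 / 4 + \<epsilon> n) * exp (- real n * E_r P Q w R))"
      by (intro P_RC_asymptotics O.expected_tie_error_at_tilted_mean num_codewords_bounds) auto
  qed
qed

end
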